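(* If $w \in F_2$ is a root word, then $|w|$ is divisible by $4$.
   Context: $F_2$ is the free group on generators $a,b$; $\overline{x}$ denotes the inverse of $x$, and $L_2=\{a,b,\overline{a},\overline{b}\}$ is the set of letters. Each element of $F_2$ is identified with its freely reduced word over $L_2$, and $|w|$ is the length of that word. $C_2$ is the set of cyclically reduced words: $w=w_1\cdots w_\ell\in F_2$ with $w_\ell\neq\overline{w_1}$ (the empty word is included). A word $w\in F_2$ is minimal if $|w|\le|\phi(w)|$ for all $\phi\in\operatorname{Aut}F_2$ (every minimal word lies in $C_2$). Child: for nonempty $w=w_1\cdots w_\ell\in C_2$ and $1\le i\le\ell$, the word $w_1\cdots w_{i-1}w_iw_iw_{i+1}\cdots w_\ell$ is a child of $w$. Words are regarded here as cyclic words: $u\in C_2$ is a child of $w$ if some cyclic rotation of $u$ is obtained in this way from some cyclic rotation of $w$. In addition, each letter $x\in L_2$ is a child of the empty word. A root word is a minimal word that is not a child of any minimal word. *)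

theory Defs
  imports "HOL-Algebra.Group"
begin

datatype gen = GenA | GenB

text \<open>
  The pair \<open>(g, True)\<close> is the generator \<open>g\<close> and \<open>(g, False)\<close> is its inverse, so the
  four letters of \<open>L\<^sub>2\<close> are exactly the elements of this type.
\<close>
type_synonym letter = "gen \<times> bool"
type_synonym word = "letter list"

definition inv_letter :: "letter \<Rightarrow> letter" where
  "inv_letter x = (fst x, \<not> snd x)"

definition reduced :: "word \<Rightarrow> bool" where
  "reduced w \<longleftrightarrow> (\<forall>i. Suc i < length w \<longrightarrow> w ! Suc i \<noteq> inv_letter (w ! i))"

text \<open>
  Left multiplication of a reduced word by a letter, with cancellation; iterating it over
  the letters of \<open>u\<close> gives the reduced form of \<open>u @ v\<close> when \<open>v\<close> is reduced.
\<close>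
fun cons_red :: "letter \<Rightarrow> word \<Rightarrow> word" where
  "cons_red x [] = [x]"
| "cons_red x (y # ys) = (if y = inv_letter x then ys else x # y # ys)"

definition mult_red :: "word \<Rightarrow> word \<Rightarrow> word" where
  "mult_red u v = foldr cons_red u v"

definition F2 :: "word monoid" where
  "F2 = \<lparr>carrier = {w. reduced w}, mult = mult_red, one = []\<rparr>"

definition C2 :: "word set" where
  "C2 = {w \<in> carrier F2. w \<noteq> [] \<longrightarrow> last w \<noteq> inv_letter (hd w)}"

definition minimal_word :: "word \<Rightarrow> bool" where
  "minimal_word w \<longleftrightarrow> w \<in> carrier F2 \<and> (\<forall>\<phi> \<in> iso F2 F2. length w \<le> length (\<phi> w))"

text \<open>Positions are counted from \<open>0\<close>; the letter \<open>w ! i\<close> is also the first letter of \<open>drop i w\<close>.\<close>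
definition double_at :: "nat \<Rightarrow> word \<Rightarrow> word" where
  "double_at i w = take i w @ w ! i # drop i w"

definition child :: "word \<Rightarrow> word \<Rightarrow> bool" where
  "child u w \<longleftrightarrow> u \<in> C2 \<and> w \<in> C2 \<and>
     (if w = [] then \<exists>x. u = [x]
      else \<exists>m n i. i < length w \<and> rotate m u = double_at i (rotate n w))"

definition root_word :: "word \<Rightarrow> bool" where
  "root_word w \<longleftrightarrow> minimal_word w \<and> \<not> (\<exists>v. minimal_word v \<and> child w v)"

lemma inv_letter_inv_letter [simp]: "inv_letter (inv_letter x) = x"
  by (simp add: inv_letter_def)

lemma reduced_Nil [simp]: "reduced []"
  by (simp add: reduced_def)

lemma reduced_Cons:
  "reduced (x # w) \<longleftrightarrow> reduced w \<and> (w \<noteq> [] \<longrightarrow> hd w \<noteq> inv_letter x)"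
proof (cases w)
  case (Cons y ys)
  have "(\<forall>i. Suc i < length (x # w) \<longrightarrow> (x # w) ! Suc i \<noteq> inv_letter ((x # w) ! i)) \<longleftrightarrow>
        w ! 0 \<noteq> inv_letter x \<and> (\<forall>i. Suc i < length w \<longrightarrow> w ! Suc i \<noteq> inv_letter (w ! i))"
    using Cons by (auto simp: nth_Cons split: nat.splits)
  then show ?thesis using Cons by (auto simp: reduced_def)
qed (simp add: reduced_def)

lemma reduced_cons_red: "reduced w \<Longrightarrow> reduced (cons_red x w)"
  by (cases w) (auto simp: reduced_Cons)

lemma cons_red_cancel: "reduced w \<Longrightarrow> cons_red x (cons_red (inv_letter x) w) = w"
  by (cases w; cases "tl w") (auto simp: reduced_Cons)

lemma reduced_mult_red: "reduced v \<Longrightarrow> reduced (mult_red u v)"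
  unfolding mult_red_def by (induction u) (auto simp: reduced_cons_red)

lemma mult_red_cons_red:
  "reduced w \<Longrightarrow> mult_red (cons_red x u) w = cons_red x (mult_red u w)"
  using cons_red_cancel[OF reduced_mult_red, of w x]
  by (cases u) (auto simp: mult_red_def)

lemma mult_red_assoc:
  "reduced w \<Longrightarrow> mult_red (mult_red u v) w = mult_red u (mult_red v w)"
proof (induction u)
  case (Cons x u)
  then show ?case
    using mult_red_cons_red[of w x "mult_red u v"] by (simp add: mult_red_def)
qed (simp add: mult_red_def)

lemma mult_red_Nil: "reduced w \<Longrightarrow> mult_red w [] = w"
proof (induction w)
  case (Cons x w)
  then show ?case by (cases w) (auto simp: mult_red_def reduced_Cons)
qed (simp add: mult_red_def)

lemma mult_red_left_inverse: "reduced w \<Longrightarrow> \<exists>v. reduced v \<and> mult_red v w = []"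
proof (induction w)
  case (Cons x w)
  then obtain v where v: "reduced v" "mult_red v w = []"
    by (auto simp: reduced_Cons)
  have "mult_red (mult_red v [inv_letter x]) (x # w) = []"
    using v mult_red_assoc[OF Cons.prems, of v "[inv_letter x]"] by (simp add: mult_red_def)
  moreover have "reduced (mult_red v [inv_letter x])"
    by (rule reduced_mult_red) (simp add: reduced_Cons)
  ultimately show ?case by blast
qed (auto simp: mult_red_def intro: exI[of _ "[]"])

lemma group_F2: "group F2"
  by (rule groupI)
    (auto simp: F2_def reduced_mult_red mult_red_assoc mult_red_left_inverse,
     simp add: mult_red_def)

end

theory Submission
  imports Defs
begin

text \<open>
  A \<^emph>\<open>sign drop\<close> of a cyclic word is a cyclically adjacent pair consisting of a positive letter
  followed by a negative one; in a cyclically reduced word this is \<open>ab\<inverse>\<close> or \<open>ba\<inverse>\<close>.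
  Write \<open>q\<close> for the number of sign drops of \<open>w\<close>, \<open>p\<close> for their number after exchanging \<open>b\<close> and
  \<open>b\<inverse>\<close>, and \<open>n\<^sub>a\<close>, \<open>n\<^sub>b\<close> for the numbers of letters over the two generators. The substitution
  \<open>a \<mapsto> ab\<close> inserts one letter for each \<open>a\<close> or \<open>a\<inverse>\<close>, and each sign drop cancels the inserted
  letter against an old one, so the cyclic length changes by \<open>n\<^sub>a - 2q\<close>. A minimal word is
  therefore cyclically reduced with \<open>2q \<le> n\<^sub>a\<close>, and by symmetry \<open>2q \<le> n\<^sub>b\<close>, \<open>2p \<le> n\<^sub>a\<close> and
  \<open>2p \<le> n\<^sub>b\<close>. These conditions also suffice for minimality (\<open>balanced_imp_minimal\<close>,
  \<open>minimal_imp_balanced\<close>).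

  This gives the theorem. Counting two-letter subwords shows that a generator with more than
  \<open>p + q\<close> letters in \<open>w\<close> has a letter that is cyclically followed by a copy of itself
  (\<open>ex_repeated_letter\<close>). If \<open>n\<^sub>a > 2 max p q\<close>, then \<open>a\<close> or \<open>a\<inverse>\<close> occurs doubled, and
  deleting one of the two copies lowers \<open>n\<^sub>a\<close> by one and keeps \<open>p\<close>, \<open>q\<close> and \<open>n\<^sub>b\<close>; the same
  applies to \<open>b\<close>. The four inequalities survive, so the shorter word is minimal and \<open>w\<close> is its
  child. Hence a root word with at least two letters satisfies \<open>n\<^sub>a = n\<^sub>b = 2 max p q\<close> and has
  length \<open>4 max p q\<close>. A word of length one is a child of the empty word.

  The sufficiency is a global statement about all automorphisms, and it rests on two facts.

  \<^item> Call a cyclically reduced word sparse if \<open>2q \<le> n\<^sub>a\<close> and \<open>2q \<le> n\<^sub>b\<close>. The substitution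
    \<open>a \<mapsto> ab\<close> turns \<open>(n\<^sub>a, n\<^sub>b, q)\<close> into \<open>(n\<^sub>a, n\<^sub>b + n\<^sub>a - 2q, q')\<close> with \<open>q' \<le> q\<close>. The two
    inequalities for \<open>w\<close> imply those for its image: \<open>2q' \<le> 2q \<le> n\<^sub>b + n\<^sub>a - 2q\<close> because
    \<open>2q \<le> n\<^sub>a\<close> and \<open>2q \<le> n\<^sub>b\<close>. The same holds for \<open>b \<mapsto> ba\<close>. So a sparse word stays sparse and
    does not become shorter under any product of these two substitutions
    (\<open>pos_pair_length_le\<close>).

  \<^item> Up to conjugation and a relabelling of the letters, each automorphism is such a product,
    possibly preceded by the exchange of \<open>b\<close> and \<open>b\<inverse>\<close> (\<open>generates_imp_signed_pair\<close>). The maps of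
    this form are closed under the elementary Nielsen moves, and Nielsen reduction brings every
    generating pair to a pair of letters by such moves and conjugations.
\<close>

section \<open>The free group of rank two as an additive group\<close>

definition inv_word :: "word \<Rightarrow> word" where
  "inv_word w = rev (map inv_letter w)"

lemma inv_word_simps [simp]:
  "inv_word [] = []"
  "inv_word (x # w) = inv_word w @ [inv_letter x]"
  "inv_word (u @ v) = inv_word v @ inv_word u"
  "inv_word (inv_word w) = w"
  "length (inv_word w) = length w"
  by (auto simp: inv_word_def rev_map comp_def)

lemma inv_letter_eq_iff [simp]: "inv_letter x = inv_letter y \<longleftrightarrow> x = y"
  by (metis inv_letter_inv_letter)

lemma inv_letter_neq [simp]: "inv_letter x \<noteq> x" "x \<noteq> inv_letter x"
  by (cases x; simp add: inv_letter_def)+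

lemma reduced_append:
  "reduced (u @ v) \<longleftrightarrow>
     reduced u \<and> reduced v \<and> (u \<noteq> [] \<longrightarrow> v \<noteq> [] \<longrightarrow> hd v \<noteq> inv_letter (last u))"
  by (induction u) (auto simp: reduced_Cons hd_append)

lemma reduced_inv_word [simp]: "reduced (inv_word w) \<longleftrightarrow> reduced w"
proof -
  have "reduced (inv_word w)" if "reduced w" for w
    using that
  proof (induction w)
    case (Cons x w)
    then show ?case
      by (cases w) (auto simp: reduced_Cons reduced_append)
  qed simp
  from this[of w] this[of "inv_word w"] show ?thesis by auto
qed

lemma mult_red_append: "reduced (u @ v) \<Longrightarrow> mult_red u v = u @ v"
proof (induction u)
  case (Cons x u)
  then show ?case
    by (cases "u @ v") (auto simp: mult_red_def reduced_Cons)
qed (simp add: mult_red_def)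

lemma mult_red_inv_word: "reduced w \<Longrightarrow> mult_red (inv_word w) w = []"
  by (induction w) (auto simp: mult_red_def reduced_Cons)

text \<open>
  The free group is written additively although it is not commutative, so that the type becomes an
  instance of \<^class>\<open>group_add\<close>: \<open>x + y\<close> is the product, \<open>- x\<close> the inverse, and
  \<open>g + x - g\<close> the conjugate of \<open>x\<close> by \<open>g\<close>.
\<close>

typedef fg = "{w. reduced w}" morphisms nf Fg
  by (rule exI[of _ "[]"]) simp

lemma reduced_nf [simp]: "reduced (nf x)"
  using nf[of x] by simp

lemma nf_Fg [simp]: "reduced w \<Longrightarrow> nf (Fg w) = w"
  by (simp add: Fg_inverse)

lemma Fg_nf [simp]: "Fg (nf x) = x"
  by (rule nf_inverse)

instantiation fg :: group_add
begin
definition zero_fg :: fg where "0 = Fg []"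
definition plus_fg :: "fg \<Rightarrow> fg \<Rightarrow> fg" where "x + y = Fg (mult_red (nf x) (nf y))"
definition uminus_fg :: "fg \<Rightarrow> fg" where "- x = Fg (inv_word (nf x))"
definition minus_fg :: "fg \<Rightarrow> fg \<Rightarrow> fg" where "x - y = x + - (y :: fg)"
instance
proof
  fix x y z :: fg
  show "x + y + z = x + (y + z)"
    by (simp add: plus_fg_def reduced_mult_red mult_red_assoc)
  show "0 + x = x" by (simp add: plus_fg_def zero_fg_def mult_red_def)
  show "x + 0 = x" by (simp add: plus_fg_def zero_fg_def mult_red_Nil)
  show "- x + x = 0" by (simp add: plus_fg_def uminus_fg_def zero_fg_def mult_red_inv_word)
  show "x + - y = x - y" by (simp add: minus_fg_def)
qed
end

lemma nf_0 [simp]: "nf 0 = []"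
  by (simp add: zero_fg_def)

lemma nf_plus: "nf (x + y) = mult_red (nf x) (nf y)"
  by (simp add: plus_fg_def reduced_mult_red)

lemma nf_uminus: "nf (- x) = inv_word (nf x)"
  by (simp add: uminus_fg_def)

definition len :: "fg \<Rightarrow> nat" where
  "len x = length (nf x)"

lemma len_0 [simp]: "len 0 = 0"
  by (simp add: len_def)

lemma len_eq_0_iff [simp]: "len x = 0 \<longleftrightarrow> x = 0"
  by (metis Fg_nf len_def length_0_conv nf_0)

lemma len_uminus [simp]: "len (- x) = len x"
  by (simp add: len_def nf_uminus)

lemma len_add_le: "len (x + y) \<le> len x + len (y :: fg)"
proof -
  have "length (cons_red c w) \<le> Suc (length w)" for c w
    by (cases w) auto
  then have "length (mult_red (c # u) v) \<le> Suc (length (mult_red u v))" for c u v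
    by (simp add: mult_red_def)
  then have "length (mult_red u v) \<le> length u + length v" for u v
    by (induction u) (simp add: mult_red_def, metis Suc_le_mono add_Suc le_trans length_Cons)
  then show ?thesis by (simp add: len_def nf_plus)
qed

lemma Fg_append: "reduced (u @ v) \<Longrightarrow> Fg (u @ v) = Fg u + Fg v"
  by (simp add: plus_fg_def mult_red_append reduced_append)

lemma len_Fg [simp]: "reduced w \<Longrightarrow> len (Fg w) = length w"
  by (simp add: len_def)

definition lt :: "letter \<Rightarrow> fg" where
  "lt c = Fg [c]"

lemma reduced_singleton [simp]: "reduced [c]"
  by (simp add: reduced_Cons)

lemma nf_lt [simp]: "nf (lt c) = [c]"
  by (simp add: lt_def)

lemma lt_eq_iff [simp]: "lt c = lt d \<longleftrightarrow> c = d"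
  by (metis list.inject nf_lt)

lemma lt_inv_letter: "lt (inv_letter c) = - lt c"
  by (simp add: lt_def uminus_fg_def)

lemma Fg_eq_sum_list: "reduced w \<Longrightarrow> Fg w = sum_list (map lt w)"
proof (induction w)
  case (Cons c w)
  have "Fg (c # w) = lt c + Fg w"
    using Fg_append[of "[c]" w] Cons.prems by (simp add: lt_def)
  with Cons show ?case by (simp add: reduced_Cons)
qed (simp add: zero_fg_def)

section \<open>Homomorphisms out of the free group\<close>

text \<open>
  A pair \<open>(x, y)\<close> of group elements stands for the endomorphism with \<open>a \<mapsto> x\<close> and \<open>b \<mapsto> y\<close>. The map
  induced by the pair is defined on all words, reduced or not, so that substitutions and rotations
  can be carried out without reducing in between.
\<close>

fun img :: "fg \<Rightarrow> fg \<Rightarrow> letter \<Rightarrow> fg" where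
  "img x y (GenA, s) = (if s then x else - x)"
| "img x y (GenB, s) = (if s then y else - y)"

definition hom_of :: "fg \<Rightarrow> fg \<Rightarrow> word \<Rightarrow> fg" where
  "hom_of x y w = sum_list (map (img x y) w)"

abbreviation "pa \<equiv> (GenA, True)"
abbreviation "na \<equiv> (GenA, False)"
abbreviation "pb \<equiv> (GenB, True)"
abbreviation "nb \<equiv> (GenB, False)"

lemma letter_cases:
  obtains "c = pa" | "c = na" | "c = pb" | "c = nb"
proof -
  obtain g s where "c = (g, s)" by (cases c)
  with that show thesis by (cases g; cases s) auto
qed

lemma inv_letter_simps [simp]:
  "inv_letter pa = na" "inv_letter na = pa" "inv_letter pb = nb" "inv_letter nb = pb"
  by (simp_all add: inv_letter_def)

lemma img_inv_letter: "img x y (inv_letter c) = - img x y c"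
  by (cases c rule: letter_cases) auto

lemma hom_of_simps [simp]:
  "hom_of x y [] = 0"
  "hom_of x y (c # w) = img x y c + hom_of x y w"
  "hom_of x y (u @ v) = hom_of x y u + hom_of x y v"
  by (simp_all add: hom_of_def)

lemma hom_of_inv_word: "hom_of x y (inv_word w) = - hom_of x y w"
  by (induction w) (simp_all add: img_inv_letter minus_add)

text \<open>
  Rewriting with these equations decides equality of two expressions in a free group of
  variables: every expression becomes a right-nested reduced sum of variables and negated variables.
\<close>

lemmas group_normalize = diff_conv_add_uminus add.assoc minus_add minus_minus minus_zero
  add_0_left add_0_right left_minus right_minus minus_add_cancel add_minus_cancel

lemma hom_of_conj: "hom_of (g + x - g) (g + y - g) w = g + hom_of x y w - g"
proof (induction w)
  case (Cons c w)
  have "img (g + x - g) (g + y - g) c = g + img x y c - g"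
    by (cases c rule: letter_cases) (simp_all add: add.assoc minus_add diff_conv_add_uminus del: add_uminus_conv_diff)
  with Cons show ?case by (simp add: add.assoc diff_conv_add_uminus del: add_uminus_conv_diff)
qed simp

lemma hom_of_rotate1: "w \<noteq> [] \<Longrightarrow> hom_of x y (rotate1 w) = - img x y (hd w) + hom_of x y w + img x y (hd w)"
  by (cases w) (simp_all add: add.assoc[symmetric])

lemma hom_of_rotate: "\<exists>g. hom_of x y (rotate m w) = g + hom_of x y w - g"
proof (induction m)
  case 0
  show ?case by (rule exI[of _ 0]) simp
next
  case (Suc m)
  then obtain g where g: "hom_of x y (rotate m w) = g + hom_of x y w - g" by blast
  show ?case
  proof (cases "w = []")
    case False
    then have "hom_of x y (rotate (Suc m) w) =
        - img x y (hd (rotate m w)) + (g + hom_of x y w - g) + img x y (hd (rotate m w))"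
      using hom_of_rotate1[of "rotate m w" x y] g by simp
    also have "\<dots> = (- img x y (hd (rotate m w)) + g) + hom_of x y w - (- img x y (hd (rotate m w)) + g)"
      by (simp add: add.assoc minus_add diff_conv_add_uminus del: add_uminus_conv_diff)
    finally show ?thesis by blast
  qed simp
qed

lemma img_lt: "img (lt pa) (lt pb) = lt"
proof
  fix c
  show "img (lt pa) (lt pb) c = lt c"
    by (cases c rule: letter_cases) (simp_all flip: lt_inv_letter)
qed

lemma hom_of_lt: "reduced w \<Longrightarrow> hom_of (lt pa) (lt pb) w = Fg w"
  by (simp add: hom_of_def img_lt Fg_eq_sum_list)

lemma hom_of_cons_red: "hom_of x y (cons_red c w) = img x y c + hom_of x y w"
  by (cases w) (auto simp: img_inv_letter)

lemma hom_of_nf_plus: "hom_of x y (nf (u + v)) = hom_of x y (nf u) + hom_of x y (nf v)"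
proof -
  have "hom_of x y (mult_red r s) = hom_of x y r + hom_of x y s" for r s
    by (induction r) (simp_all add: mult_red_def hom_of_cons_red add.assoc)
  then show ?thesis by (simp add: nf_plus)
qed

section \<open>Positive substitutions and Nielsen moves\<close>

text \<open>
  Starting from a pair of letters, the rules \<open>addL\<close> and \<open>addR\<close> precompose the endomorphism with
  \<open>a \<mapsto> ab\<close> and with \<open>b \<mapsto> ba\<close>. Up to conjugation and relabelling of letters, the pairs obtained
  are the products of these two positive substitutions.
\<close>

inductive pos_pair :: "fg \<Rightarrow> fg \<Rightarrow> bool" where
  letters: "fst c \<noteq> fst d \<Longrightarrow> pos_pair (lt c) (lt d)"
| addL: "pos_pair x y \<Longrightarrow> pos_pair (x + y) y"
| addR: "pos_pair x y \<Longrightarrow> pos_pair x (y + x)"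
| conj: "pos_pair x y \<Longrightarrow> pos_pair (g + x - g) (g + y - g)"

lemma pos_pair_swap: "pos_pair x y \<Longrightarrow> pos_pair y x"
proof (induction rule: pos_pair.induct)
  case (letters c d)
  then show ?case by (simp add: pos_pair.letters)
qed (auto intro: pos_pair.intros)

text \<open>
  Inverting both entries of \<open>(xy, y)\<close> gives \<open>(y\<inverse>x\<inverse>, y\<inverse>)\<close>, while \<open>addL\<close> applied to the inverted
  pair gives \<open>(x\<inverse>y\<inverse>, y\<inverse>)\<close>. The two differ by a conjugation, which is why positive pairs are
  taken up to conjugation.
\<close>

lemma pos_pair_uminus: "pos_pair x y \<Longrightarrow> pos_pair (- x) (- y)"
proof (induction rule: pos_pair.induct)
  case (letters c d)
  then show ?case
    using pos_pair.letters[of "inv_letter c" "inv_letter d"]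
    by (simp add: lt_inv_letter) (simp add: inv_letter_def)
next
  case (addL x y)
  from pos_pair.conj[OF pos_pair.addL[OF addL.IH], of "- y"] show ?case
    by (simp only: group_normalize)
next
  case (addR x y)
  from pos_pair.conj[OF pos_pair.addR[OF addR.IH], of "- x"] show ?case
    by (simp only: group_normalize)
next
  case (conj x y g)
  from pos_pair.conj[OF conj.IH, of g] show ?case
    by (simp only: group_normalize)
qed

text \<open>
  The second alternative covers the substitutions positive in \<open>a\<close> and \<open>b\<inverse>\<close>. Every automorphism
  turns out to be of one of the two kinds. The abelianized form of this fact is that the two columns
  of an invertible \<open>2 \<times> 2\<close> integer matrix lie in one closed quadrant or in two opposite ones.
\<close>

definition signed_pair :: "fg \<Rightarrow> fg \<Rightarrow> bool" where
  "signed_pair x y \<longleftrightarrow> pos_pair x y \<or> pos_pair x (- y)"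

text \<open>
  The move \<open>a \<mapsto> ab\<inverse>\<close> either cancels against a preceding \<open>a \<mapsto> ab\<close>, or meets \<open>b \<mapsto> ba\<close>, where
  \<open>(x, yx)\<close> becomes \<open>(y\<inverse>, yx)\<close>. The latter pair has positive shape with respect to \<open>a\<close> and \<open>b\<inverse>\<close>,
  since \<open>(y\<inverse>, x\<inverse>y\<inverse>)\<close> arises from \<open>(y\<inverse>, x\<inverse>)\<close> by \<open>b \<mapsto> ba\<close>.
\<close>

lemma pos_pair_diff: "pos_pair x y \<Longrightarrow> signed_pair (x - y) y"
proof (induction rule: pos_pair.induct)
  case (letters c d)
  then have "pos_pair (lt c) (lt (inv_letter d))"
    by (intro pos_pair.letters) (simp add: inv_letter_def)
  from pos_pair.addL[OF this] show ?case
    by (simp add: signed_pair_def lt_inv_letter)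
next
  case (addL x y)
  then show ?case by (simp add: signed_pair_def)
next
  case (addR x y)
  from pos_pair.addR[OF pos_pair_swap[OF pos_pair_uminus[OF addR.hyps]]] show ?case
    unfolding signed_pair_def by (simp only: group_normalize simp_thms)
next
  case (conj x y g)
  from conj.IH have "pos_pair (g + (x - y) - g) (g + y - g) \<or> pos_pair (g + (x - y) - g) (g + - y - g)"
    unfolding signed_pair_def by (blast intro: pos_pair.conj)
  then show ?case
    unfolding signed_pair_def by (simp only: group_normalize)
qed

lemma signed_pair_uminus_right: "signed_pair x y \<Longrightarrow> signed_pair x (- y)"
  by (auto simp: signed_pair_def)

lemma signed_pair_swap: "signed_pair x y \<Longrightarrow> signed_pair y x"
  using pos_pair_swap pos_pair_uminus[of x "- y"] by (auto simp: signed_pair_def)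

lemma signed_pair_uminus_left: "signed_pair x y \<Longrightarrow> signed_pair (- x) y"
  by (blast intro: signed_pair_swap signed_pair_uminus_right)

lemma signed_pair_conj: "signed_pair x y \<Longrightarrow> signed_pair (g + x - g) (g + y - g)"
  unfolding signed_pair_def using pos_pair.conj[of x y g] pos_pair.conj[of x "- y" g]
  by (auto simp only: group_normalize)

lemma signed_pair_diff: "signed_pair x y \<Longrightarrow> signed_pair (x - y) y"
  using pos_pair_diff[of x y] pos_pair.addL[of x "- y"] by (auto simp: signed_pair_def)

lemma signed_pair_add: "signed_pair x y \<Longrightarrow> signed_pair (x + y) y"
  using signed_pair_diff[of x "- y"] signed_pair_uminus_right[of x y] signed_pair_uminus_right[of "x + y" "- y"] by simp

lemma signed_pair_uminus_left_iff [simp]: "signed_pair (- x) y \<longleftrightarrow> signed_pair x y"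
  using signed_pair_uminus_left[of x y] signed_pair_uminus_left[of "- x" y] by auto

lemma signed_pair_uminus_right_iff [simp]: "signed_pair x (- y) \<longleftrightarrow> signed_pair x y"
  using signed_pair_uminus_right[of x y] signed_pair_uminus_right[of x "- y"] by auto

lemma signed_pair_add_left_iff [simp]: "signed_pair (x + y) y \<longleftrightarrow> signed_pair x y"
  using signed_pair_add[of x y] signed_pair_diff[of "x + y" y] by auto

lemma signed_pair_conj_iff: "signed_pair (g + x - g) (g + y - g) \<longleftrightarrow> signed_pair x y"
  using signed_pair_conj[of x y g] signed_pair_conj[of "g + x - g" "g + y - g" "- g"]
  by (auto simp only: group_normalize)

lemma signed_pair_add_right_iff [simp]: "signed_pair x (x + y) \<longleftrightarrow> signed_pair x y"
proof -
  have "signed_pair x (x + y) \<longleftrightarrow> signed_pair (- x + x - - x) (- x + (x + y) - - x)"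
    by (rule signed_pair_conj_iff[symmetric])
  also have "\<dots> \<longleftrightarrow> signed_pair x (y + x)"
    by (simp only: group_normalize)
  finally show ?thesis
    by (metis signed_pair_add_left_iff signed_pair_swap)
qed

section \<open>Nielsen reduction\<close>

fun lcp :: "'a list \<Rightarrow> 'a list \<Rightarrow> nat" where
  "lcp (x # xs) (y # ys) = (if x = y then Suc (lcp xs ys) else 0)"
| "lcp _ _ = 0"

lemma lcp_Nil_right [simp]: "lcp xs [] = 0"
  by (cases xs) auto

lemma lcp_commute: "lcp xs ys = lcp ys xs"
  by (induction xs ys rule: lcp.induct) auto

lemma lcp_le: "lcp xs ys \<le> length xs"
  by (induction xs ys rule: lcp.induct) auto

text \<open>
  The reduced words are the vertices of a tree; this is the statement that the tree is
  \<open>0\<close>-hyperbolic, and it is what makes cancellation in long products computable from cancellation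
  between neighbouring factors.
\<close>

lemma lcp_ultrametric: "min (lcp xs ys) (lcp ys zs) \<le> lcp xs zs"
proof (induction xs ys arbitrary: zs rule: lcp.induct)
  case (1 x xs y ys)
  from 1[of "tl zs"] show ?case by (cases zs) auto
qed auto

lemma take_lcp: "take (lcp xs ys) xs = take (lcp xs ys) ys"
  by (induction xs ys rule: lcp.induct) auto

lemma mult_red_Nil_left: "mult_red [] v = v"
  by (simp add: mult_red_def)

lemma length_mult_red_inv_word:
  "reduced u \<Longrightarrow> reduced v \<Longrightarrow> length (mult_red (inv_word u) v) + 2 * lcp u v = length u + length v"
proof (induction u v rule: lcp.induct)
  case (1 x u y v)
  show ?case
  proof (cases "x = y")
    case True
    have "mult_red (inv_word (x # u)) (y # v) = mult_red (inv_word u) v"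
      using True by (simp add: mult_red_def)
    with 1 True show ?thesis by (auto simp: reduced_Cons)
  next
    case False
    have "reduced (inv_word (x # u))"
      using "1.prems"(1) by (simp only: reduced_inv_word)
    moreover have "last (inv_word (x # u)) = inv_letter x" by simp
    ultimately have "reduced (inv_word (x # u) @ y # v)"
      unfolding reduced_append using "1.prems"(2) False by simp
    from mult_red_append[OF this] False show ?thesis by simp
  qed
qed (auto simp: mult_red_Nil mult_red_Nil_left)

text \<open>
  The Gromov product based at the identity; \<open>gromov (- x) y\<close> is the number of letters that cancel
  from either side in the product \<open>x + y\<close>.
\<close>

definition gromov :: "fg \<Rightarrow> fg \<Rightarrow> nat" where
  "gromov x y = lcp (nf x) (nf y)"

lemma gromov_commute: "gromov x y = gromov y x"
  by (simp add: gromov_def lcp_commute)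

lemma gromov_ultrametric: "min (gromov x y) (gromov y z) \<le> gromov x z"
  by (simp add: gromov_def lcp_ultrametric)

lemma len_gromov: "len (- x + y) + 2 * gromov x y = len x + len y"
  by (simp add: len_def gromov_def nf_plus nf_uminus length_mult_red_inv_word)

lemma len_add_gromov: "len (x + y) + 2 * gromov (- x) y = len x + len y"
  using len_gromov[of "- x" y] by simp

lemma gromov_le: "gromov x y \<le> len x" "gromov x y \<le> len y"
  using lcp_le[of "nf x" "nf y"] lcp_le[of "nf y" "nf x"]
  by (simp_all add: gromov_def len_def lcp_commute)

text \<open>
  If at least half of \<open>x\<close> cancelled in \<open>x + x\<close>, then the first half of the word for \<open>x\<close> would be
  the formal inverse of its second half. This is impossible: two inverse letters would meet in the
  middle, or, for odd length, the middle letter would be its own inverse.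
\<close>

lemma gromov_uminus_self:
  assumes "x \<noteq> 0"
  shows "2 * gromov (- x) x < len x"
proof (rule ccontr)
  assume contr: "\<not> ?thesis"
  define w where "w = nf x"
  define n where "n = length w"
  define k where "k = gromov (- x) x"
  have k: "n \<le> 2 * k" using contr by (simp add: n_def w_def k_def len_def)
  have "n > 0" using assms len_eq_0_iff[of x] by (simp add: n_def w_def len_def)
  have kn: "k \<le> n" using gromov_le(2)[of "- x" x] by (simp add: k_def n_def w_def len_def)
  have "take k (inv_word w) = take k w"
    unfolding k_def w_def gromov_def nf_uminus by (rule take_lcp)
  then have prefix: "w ! i = inv_word w ! i" if "i < k" for i
    using that nth_take[of i k w] nth_take[of i k "inv_word w"] by simp
  have *: "w ! i = inv_letter (w ! (n - 1 - i))" if "i < k" for i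
  proof -
    have "w ! i = inv_word w ! i" by (rule prefix[OF that])
    also have "\<dots> = inv_letter (w ! (n - 1 - i))"
      using that kn by (simp add: inv_word_def rev_nth n_def)
    finally show ?thesis .
  qed
  show False
  proof (cases "even n")
    case True
    then obtain m where m: "n = 2 * m" by blast
    then have "w ! (m - 1) = inv_letter (w ! m)"
      using *[of "m - 1"] k \<open>n > 0\<close> by (simp add: mult_2)
    then have "w ! Suc (m - 1) = inv_letter (w ! (m - 1))"
      using m \<open>n > 0\<close> by simp
    moreover have "Suc (m - 1) < length w" using m \<open>n > 0\<close> by (simp add: n_def)
    moreover have "reduced w" by (simp add: w_def)
    ultimately show False unfolding reduced_def by blast
  next
    case False
    then obtain m where "n = 2 * m + 1" by (metis oddE)
    with *[of m] k show False by simp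
  qed
qed

definition generates :: "fg \<Rightarrow> fg \<Rightarrow> bool" where
  "generates x y \<longleftrightarrow> (\<forall>z. \<exists>w. hom_of x y w = z)"

lemma generates_mono:
  assumes "generates x y" and "hom_of x' y' u = x" and "hom_of x' y' v = y"
  shows "generates x' y'"
proof -
  have "\<exists>w'. hom_of x' y' w' = hom_of x y w" for w
  proof (induction w)
    case Nil
    show ?case by (rule exI[of _ "[]"]) simp
  next
    case (Cons c w)
    then obtain w' where w': "hom_of x' y' w' = hom_of x y w" by blast
    have "\<exists>r. hom_of x' y' r = img x y c"
      by (cases c rule: letter_cases) (use assms(2,3) hom_of_inv_word[of x' y'] in \<open>simp, blast\<close>)+
    then obtain r where "hom_of x' y' r = img x y c" by blast
    with w' have "hom_of x' y' (r @ w') = hom_of x y (c # w)" by simp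
    then show ?case by blast
  qed
  with assms(1) show ?thesis unfolding generates_def by metis
qed

lemma generates_reduced:
  assumes "generates x y"
  obtains w where "reduced w" and "hom_of x y w = z"
proof -
  obtain w where "hom_of x y w = z" using assms by (auto simp: generates_def)
  moreover have "hom_of x y (mult_red w []) = hom_of x y w"
    by (induction w) (simp_all add: mult_red_def hom_of_cons_red)
  ultimately show thesis
    using that[of "mult_red w []"] by (simp add: reduced_mult_red)
qed

lemma generates_conj: "generates x y \<Longrightarrow> generates (g + x - g) (g + y - g)"
  unfolding generates_def hom_of_conj
proof
  fix z
  assume "\<forall>z. \<exists>w. hom_of x y w = z"
  then obtain w where "hom_of x y w = - g + z + g" by blast
  then have "g + hom_of x y w - g = z" by (simp only: group_normalize)
  then show "\<exists>w. g + hom_of x y w - g = z" by blast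
qed

lemma generates_img:
  assumes "fst c \<noteq> fst d" and "generates x y"
  shows "generates (img x y c) (img x y d)"
proof -
  have "\<exists>u. hom_of (img x y c) (img x y d) u = x" "\<exists>u. hom_of (img x y c) (img x y d) u = y"
    by (cases c rule: letter_cases; cases d rule: letter_cases; use assms(1) in simp;
        use exI[of _ "[pa]"] exI[of _ "[na]"] exI[of _ "[pb]"] exI[of _ "[nb]"] in force)+
  with generates_mono[OF assms(2)] show ?thesis by metis
qed

lemma signed_pair_img: "fst c \<noteq> fst d \<Longrightarrow> signed_pair (img x y c) (img x y d) \<longleftrightarrow> signed_pair x y"
  by (cases c rule: letter_cases; cases d rule: letter_cases) (auto intro: signed_pair_swap)

lemma len_img: "fst c \<noteq> fst d \<Longrightarrow> len (img x y c) + len (img x y d) = len x + len y"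
  by (cases c rule: letter_cases; cases d rule: letter_cases) auto

text \<open>
  The elements \<open>hom_of 0 y w\<close> are powers of \<open>y\<close>, so they commute; but \<open>ab \<noteq> ba\<close>.
\<close>

lemma not_generates_0: "\<not> generates 0 y"
proof
  assume "generates 0 y"
  have 1: "hom_of 0 y w + v = v + hom_of 0 y w" if "\<And>c. img 0 y c + v = v + img 0 y c" for w v
  proof (induction w)
    case (Cons c w)
    have "img 0 y c + hom_of 0 y w + v = img 0 y c + (v + hom_of 0 y w)"
      using Cons.IH by (simp add: add.assoc)
    also have "\<dots> = v + img 0 y c + hom_of 0 y w"
      using that[of c] by (simp add: add.assoc[symmetric])
    finally show ?case by (simp add: add.assoc)
  qed simp
  have "img 0 y c + img 0 y d = img 0 y d + img 0 y c" for c d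
    by (cases c rule: letter_cases; cases d rule: letter_cases) auto
  then have "img 0 y c + hom_of 0 y w = hom_of 0 y w + img 0 y c" for c w
    using 1[of "img 0 y c" w] by simp
  then have "hom_of 0 y w + hom_of 0 y w' = hom_of 0 y w' + hom_of 0 y w" for w w'
    using 1[of "hom_of 0 y w'" w] by simp
  moreover obtain w w' where "hom_of 0 y w = lt pa" "hom_of 0 y w' = lt pb"
    using \<open>generates 0 y\<close> unfolding generates_def by metis
  ultimately have "nf (lt pa + lt pb) = nf (lt pb + lt pa)" by metis
  then show False by (simp add: nf_plus mult_red_def)
qed

lemma generates_neq_0:
  assumes "generates x y"
  shows "img x y c \<noteq> 0"
proof -
  have "x \<noteq> 0" using assms not_generates_0 by auto
  moreover have "generates y x" using generates_img[of pb pa x y] assms by simp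
  then have "y \<noteq> 0" using not_generates_0 by auto
  ultimately show ?thesis by (cases c rule: letter_cases) auto
qed

text \<open>
  Nielsen's cancellation argument. At most half of each factor cancels on either side (\<open>half\<close>), and
  the two cancellations never use up a factor completely (\<open>sep\<close>). So a nonempty piece of each
  factor survives in a reduced product, and a product of at least two factors has length at least
  two.
\<close>

lemma len_hom_of_ge_2:
  assumes ne: "\<And>c. img x y c \<noteq> 0"
    and half: "\<And>c d. d \<noteq> inv_letter c \<Longrightarrow> 2 * gromov (- img x y c) (img x y d) \<le> len (img x y c)"
      "\<And>c d. d \<noteq> inv_letter c \<Longrightarrow> 2 * gromov (- img x y c) (img x y d) \<le> len (img x y d)"
    and sep: "\<And>c d f. d \<noteq> inv_letter c \<Longrightarrow> f \<noteq> inv_letter d \<Longrightarrow>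
      gromov (- img x y c) (img x y d) + gromov (- img x y d) (img x y f) < len (img x y d)"
    and red: "reduced w" "length w \<ge> 2"
  shows "len (hom_of x y w) \<ge> 2"
proof -
  define e where "e = img x y"
  define k where "k = (\<lambda>d r. case r of [] \<Rightarrow> 0 | f # _ \<Rightarrow> gromov (- e d) (e f))"
  have pos_pair: "len (e c) > 0" for c using ne[of c] by (simp add: e_def flip: len_eq_0_iff)
  (* Here k d r is what the next factor cancels from e d: the value of d # r begins with
     the rest of e d, which shields the earlier factors from everything after e d. *)
  have main: "gromov (e d) (hom_of x y (d # r)) + k d r = len (e d) \<and>
      len (hom_of x y (d # r)) + k d r \<ge> len (e d) + (if r = [] then 0 else 1)"
    if "reduced (d # r)" for d r
    using that
  proof (induction r arbitrary: d)
    case Nil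
    have "2 * gromov (e d) (e d) = 2 * len (e d)"
      using len_gromov[of "e d" "e d"] by simp
    then show ?case by (simp add: k_def e_def)
  next
    case (Cons f r)
    define z where "z = hom_of x y (f # r)"
    have red': "reduced (f # r)" "f \<noteq> inv_letter d"
      using Cons.prems by (auto simp: reduced_Cons)
    have IH: "gromov (e f) z + k f r = len (e f)" "len z + k f r \<ge> len (e f)"
      using Cons.IH[OF red'(1)] by (auto simp: z_def)
    have "gromov (- e d) (e f) + k f r < len (e f)"
    proof (cases r)
      case Nil
      then show ?thesis using half(2)[OF red'(2)] pos_pair[of f] by (simp add: k_def e_def)
    next
      case (Cons g r')
      then have "g \<noteq> inv_letter f" using red' by (simp add: reduced_Cons)
      then show ?thesis using sep[OF red'(2)] Cons by (simp add: k_def e_def)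
    qed
    then have lt: "gromov (- e d) (e f) < gromov (e f) z" "gromov (- e d) (e f) < len z"
      using IH by auto
    (* z shares with e f a longer prefix than - e d does, so - e d branches off from z
       exactly where it branches off from e f. *)
    have gpz: "gromov (- e d) z = gromov (- e d) (e f)"
      using gromov_ultrametric[of "- e d" "e f" z] gromov_ultrametric[of "- e d" z "e f"] lt
        gromov_commute[of z "e f"] by linarith
    have 1: "len (e d + z) + 2 * gromov (- e d) (e f) = len (e d) + len z"
      using len_add_gromov[of "e d" z] gpz by simp
    have 2: "len z + 2 * gromov (e d) (e d + z) = len (e d) + len (e d + z)"
      using len_gromov[of "e d" "e d + z"] by simp
    have "hom_of x y (d # f # r) = e d + z" by (simp add: z_def e_def)
    then show ?case using 1 2 lt by (simp add: k_def del: hom_of_simps)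
  qed
  obtain c d r where w: "w = c # d # r"
    using red(2) by (metis Suc_le_length_iff numeral_2_eq_2)
  then have "d \<noteq> inv_letter c" using red(1) by (simp add: reduced_Cons)
  from main[of c "d # r"] half(1)[OF this] pos_pair[of c] red(1) w show ?thesis
    by (simp add: k_def e_def del: hom_of_simps)
qed

text \<open>
  The one obstruction to Nielsen's argument that no single elementary move removes: the first half
  of \<open>v\<close> cancels into \<open>t\<close> on one side and the second half on the other. Then \<open>v = pq\<close> and
  \<open>t = pmq\<close> without cancellation and with \<open>|p| = |q|\<close>. Conjugating the pair \<open>(v, v\<inverse>t)\<close> by \<open>q\<close> gives
  \<open>(qp, m)\<close>, and \<open>m\<close> is shorter than \<open>t\<close> by the length of \<open>v\<close>.
\<close>

lemma tie_conj_shortens: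
  assumes v: "v \<noteq> 0" and le: "len v \<le> len t"
    and 1: "2 * gromov v t = len v" and 2: "2 * gromov (- v) (- t) = len v"
  obtains q where "len (q + v - q) + len (q + (- v + t) - q) < len v + len t"
proof -
  define h where "h = gromov v t"
  define p where "p = take h (nf v)"
  define q where "q = drop h (nf v)"
  have lv: "length (nf v) = 2 * h" using 1 by (simp add: h_def len_def)
  have pq: "nf v = p @ q" by (simp add: p_def q_def)
  have tp: "take h (nf t) = p"
    using take_lcp[of "nf v" "nf t"] by (simp add: p_def h_def gromov_def)
  have "gromov (- v) (- t) = h" using 1 2 by (simp add: h_def)
  then have "take h (inv_word (nf v)) = take h (inv_word (nf t))"
    using take_lcp[of "nf (- v)" "nf (- t)"] by (simp add: gromov_def nf_uminus)
  then have "inv_word (drop (length (nf v) - h) (nf v)) = inv_word (drop (length (nf t) - h) (nf t))"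
    by (simp add: inv_word_def take_rev take_map drop_map)
  then have tq: "drop (length (nf t) - h) (nf t) = q"
    using lv inv_word_simps(4) by (metis add_diff_cancel_right' mult_2 q_def)
  define m where "m = take (length (nf t) - 2 * h) (drop h (nf t))"
  have lt: "2 * h \<le> length (nf t)" using le lv by (simp add: len_def)
  have "nf t = take h (nf t) @ drop h (nf t)" by simp
  also have "drop h (nf t) = m @ drop (length (nf t) - 2 * h) (drop h (nf t))"
    unfolding m_def by (rule append_take_drop_id[symmetric])
  also have "drop (length (nf t) - 2 * h) (drop h (nf t)) = q"
    using tq lt by (simp add: mult_2)
  finally have t: "nf t = p @ m @ q" using tp by simp
  have red: "reduced (p @ q)" "reduced (p @ m @ q)"
    by (metis pq reduced_nf, metis t reduced_nf)
  have v': "v = Fg p + Fg q"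
    using Fg_append[OF red(1)] pq by (metis Fg_nf)
  have t': "t = Fg p + (Fg m + Fg q)"
    using Fg_append[OF red(2)] Fg_append[of m q] red(2) t by (metis Fg_nf reduced_append)
  have "Fg q + v - Fg q = Fg q + Fg p"
    unfolding v' by (simp only: group_normalize)
  moreover have "len (Fg q + Fg p) \<le> len (Fg q) + len (Fg p)"
    by (rule len_add_le)
  then have "len (Fg q + Fg p) \<le> 2 * h"
    using red(1) lv pq by (simp add: reduced_append)
  moreover have "Fg q + (- v + t) - Fg q = Fg m"
    unfolding v' t' by (simp only: group_normalize)
  moreover have "len (Fg m) + 2 * h = len t"
    using red(2) lt by (simp add: reduced_append m_def len_def)
  moreover have "h > 0" using 1 v by (simp add: h_def flip: len_eq_0_iff)
  moreover have "len v = 2 * h" using lv by (simp add: len_def)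
  ultimately have "len (Fg q + v - Fg q) + len (Fg q + (- v + t) - Fg q) < len v + len t"
    by simp
  then show thesis by (rule that)
qed

text \<open>
  Nielsen reduction by induction on the total length of the pair. If a product of two entries, with
  signs, is shorter than one of its factors, or if the tie above occurs, then a move that preserves
  \<^const>\<open>signed_pair\<close> shortens the pair. Otherwise a product of two or more factors has length at
  least two, so each single letter must be one of the entries or its inverse.
\<close>

theorem generates_imp_signed_pair: "generates x y \<Longrightarrow> signed_pair x y"
proof (induction "len x + len y" arbitrary: x y rule: less_induct)
  case less
  define e where "e = img x y"
  note gen = less.prems
  have ne: "e c \<noteq> 0" for c using generates_neq_0[OF gen] by (simp add: e_def)
  have len_inv: "len (e (inv_letter c)) = len (e c)" for c by (simp add: e_def img_inv_letter)
  show ?case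
  proof (cases "\<exists>c d. fst c \<noteq> fst d \<and> (len (e c + e d) < len (e c) \<or> len (e c + e d) < len (e d))")
    case True
    then obtain c d where shorten: "fst c \<noteq> fst d"
      "len (e c + e d) < len (e c) \<or> len (e c + e d) < len (e d)" by blast
    define u v where "u = e c" and "v = e d"
    have uv: "generates u v" "signed_pair u v \<longleftrightarrow> signed_pair x y" "len u + len v = len x + len y"
      using generates_img[OF shorten(1) gen] signed_pair_img[OF shorten(1)] len_img[OF shorten(1)]
      by (simp_all add: u_def v_def e_def)
    have "generates (u + v) v"
      by (rule generates_mono[OF uv(1), of _ _ "[pa, nb]" "[pb]"]) simp_all
    moreover have "generates u (u + v)"
      by (rule generates_mono[OF uv(1), of _ _ "[pa]" "[na, pb]"]) simp_all
    ultimately show ?thesis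
      using shorten(2) less.hyps[of "u + v" v] less.hyps[of u "u + v"] uv
      by (auto simp flip: u_def v_def)
  next
    case False
    have long: "len (e c) \<le> len (e c + e d)" "len (e d) \<le> len (e c + e d)"
      if "fst c \<noteq> fst d" for c d
    proof -
      from False that have "\<not> (len (e c + e d) < len (e c) \<or> len (e c + e d) < len (e d))"
        by blast
      then show "len (e c) \<le> len (e c + e d)" "len (e d) \<le> len (e c + e d)" by simp_all
    qed
    have half: "2 * gromov (- e c) (e d) \<le> len (e c)" "2 * gromov (- e c) (e d) \<le> len (e d)"
      if "fst c \<noteq> fst d" for c d
      using len_add_gromov[of "e c" "e d"] long[OF that] by linarith+
    have same: "2 * gromov (- e c) (e c) < len (e c)" for c
      using gromov_uminus_self[OF ne] .
    have eq: "d = c" if "d \<noteq> inv_letter c" "fst c = fst d" for c d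
      using that by (cases c; cases d) (auto simp: inv_letter_def)
    have half': "2 * gromov (- e c) (e d) \<le> len (e c) \<and> 2 * gromov (- e c) (e d) \<le> len (e d)"
      if "d \<noteq> inv_letter c" for c d
    proof (cases "fst c = fst d")
      case True
      with eq[OF that] same[of c] show ?thesis by simp
    next
      case False
      with half show ?thesis by blast
    qed
    show ?thesis
    proof (cases "\<exists>c d f. d \<noteq> inv_letter c \<and> f \<noteq> inv_letter d \<and>
        len (e d) \<le> gromov (- e c) (e d) + gromov (- e d) (e f)")
      case True
      then obtain c d f where tie: "d \<noteq> inv_letter c" "f \<noteq> inv_letter d"
        "gromov (- e c) (e d) + gromov (- e d) (e f) \<ge> len (e d)" by blast
      define v t where "v = e d" and "t = - e c"
      have e1: "2 * gromov t v = len v" and e2: "2 * gromov (- v) (e f) = len v"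
        using half'[OF tie(1)] half'[OF tie(2)] tie(3) unfolding v_def t_def by linarith+
      have cd: "fst c \<noteq> fst d"
      proof
        assume "fst c = fst d"
        with eq[OF tie(1)] e1 same[of d] show False by (simp add: v_def t_def)
      qed
      have fd: "fst f \<noteq> fst d"
      proof
        assume "fst f = fst d"
        with eq[OF tie(2)] e2 same[of d] show False by (simp add: v_def)
      qed
      from cd fd have "fst f = fst c"
        by (cases "fst c"; cases "fst d"; cases "fst f") simp_all
      then have "f = c \<or> f = inv_letter c"
        using eq[of f c] by (metis inv_letter_inv_letter)
      moreover have "f \<noteq> inv_letter c"
      proof
        assume "f = inv_letter c"
        then have "e f = t" by (simp add: e_def t_def img_inv_letter)
        then have "2 * gromov (- v) t = len v" using e2 by simp
        with gromov_ultrametric[of "- v" t v] e1 have "len v \<le> 2 * gromov (- v) v" by linarith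
        with same[of d] show False by (simp add: v_def)
      qed
      ultimately have "e f = - t" by (simp add: t_def)
      have "len v \<le> len t"
        using half(1)[OF cd] e1 by (simp add: t_def v_def)
      moreover have "v \<noteq> 0" using ne by (simp add: v_def)
      moreover have "2 * gromov v t = len v" "2 * gromov (- v) (- t) = len v"
        using e1 e2 \<open>e f = - t\<close> gromov_commute[of v t] by simp_all
      ultimately obtain q where q: "len (q + v - q) + len (q + (- v + t) - q) < len v + len t"
        using tie_conj_shortens[of v t] by blast
      have fst: "fst d \<noteq> fst (inv_letter c)" using cd by (simp add: inv_letter_def)
      have t: "t = e (inv_letter c)" by (simp add: t_def e_def img_inv_letter)
      have vt: "generates v t" "signed_pair v t \<longleftrightarrow> signed_pair x y" "len v + len t = len x + len y"
        using generates_img[OF fst gen] signed_pair_img[OF fst] len_img[OF fst]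
        by (simp_all add: v_def t e_def)
      have "generates v (- v + t)"
        by (rule generates_mono[OF vt(1), of _ _ "[pa]" "[pa, pb]"]) (simp_all add: add.assoc[symmetric])
      from less.hyps[OF _ generates_conj[OF this]] q vt(3)
      have "signed_pair (q + v - q) (q + (- v + t) - q)" by simp
      then have "signed_pair v (- v + t)" by (simp only: signed_pair_conj_iff)
      then have "signed_pair v (v + (- v + t))" by (simp only: signed_pair_add_right_iff)
      with vt(2) show ?thesis by simp
    next
      case False
      have sep: "gromov (- e c) (e d) + gromov (- e d) (e f) < len (e d)"
        if "d \<noteq> inv_letter c" "f \<noteq> inv_letter d" for c d f
      proof -
        from False that have "\<not> len (e d) \<le> gromov (- e c) (e d) + gromov (- e d) (e f)" by blast
        then show ?thesis by simp
      qed
      have "\<exists>d. lt c = e d" for c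
      proof -
        obtain w where w: "reduced w" "hom_of x y w = lt c"
          using generates_reduced[OF gen] .
        have "len (lt c) = 1" by (simp add: len_def)
        then have "\<not> 2 \<le> length w"
          using len_hom_of_ge_2[OF ne[unfolded e_def] _ _ sep[unfolded e_def] w(1)]
            half'[unfolded e_def] w(2) by auto
        moreover have "w \<noteq> []" using w \<open>len (lt c) = 1\<close> by auto
        ultimately obtain d where "w = [d]" by (cases w; cases "tl w") auto
        then have "lt c = e d" using w by (simp add: e_def)
        then show ?thesis by (rule exI)
      qed
      then obtain c d where cd: "lt pa = e c" "lt pb = e d" by blast
      have "lt pa \<noteq> lt pb" "lt pa \<noteq> - lt pb"
        using lt_inv_letter[of pb] by (simp_all flip: lt_inv_letter)
      then have "fst c \<noteq> fst d"
        unfolding cd by (cases c rule: letter_cases; cases d rule: letter_cases) (auto simp: e_def)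
      moreover have "signed_pair (e c) (e d)"
        unfolding cd[symmetric] signed_pair_def using pos_pair.letters[of pa pb] by simp
      ultimately show ?thesis using signed_pair_img unfolding e_def by blast
    qed
  qed
qed

section \<open>Sign drops of cyclic words\<close>

text \<open>
  The cyclically adjacent pairs, including the pair of the last and the first letter. For a word
  \<open>[c]\<close> this is the single pair \<open>(c, c)\<close>.
\<close>

definition gaps :: "word \<Rightarrow> (letter \<times> letter) list" where
  "gaps w = zip w (rotate1 w)"

definition cyc_reduced :: "word \<Rightarrow> bool" where
  "cyc_reduced w \<longleftrightarrow> (\<forall>(u, v) \<in> set (gaps w). v \<noteq> inv_letter u)"

definition gen_count :: "gen \<Rightarrow> word \<Rightarrow> nat" where
  "gen_count g w = length (filter (\<lambda>c. fst c = g) w)"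

definition drops :: "word \<Rightarrow> nat" where
  "drops w = length (filter (\<lambda>(u, v). snd u \<and> \<not> snd v) (gaps w))"

lemma gaps_Nil [simp]: "gaps [] = []"
  by (simp add: gaps_def)

lemma gaps_Cons: "gaps (c # w) = zip (c # w) w @ [(last (c # w), c)]"
proof -
  have "zip (b # w) (w @ [c]) = zip (b # w) w @ [(last (b # w), c)]" for b
    by (induction w arbitrary: b) simp_all
  from this[of c] show ?thesis by (simp add: gaps_def)
qed

lemma gaps_rotate: "gaps (rotate m w) = rotate m (gaps w)"
proof -
  have "zip (rotate1 u) (rotate1 v) = rotate1 (zip u v)" if "length u = length v" for u v :: word
    using that by (cases u; cases v) auto
  then have "gaps (rotate1 u) = rotate1 (gaps u)" for u
    by (simp add: gaps_def)
  then show ?thesis by (induction m) simp_all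
qed

lemma gaps_map: "gaps (map f w) = map (map_prod f f) (gaps w)"
  by (simp add: gaps_def rotate1_map zip_map_map map_prod_def case_prod_beta)

lemma length_filter_rotate: "length (filter P (rotate m xs)) = length (filter P xs)"
proof -
  have "length (filter P (rotate1 xs)) = length (filter P xs)" for xs
    by (cases xs) auto
  then show ?thesis by (induction m) simp_all
qed

lemma drops_rotate [simp]: "drops (rotate m w) = drops w"
  by (simp add: drops_def gaps_rotate length_filter_rotate)

lemma gen_count_rotate [simp]: "gen_count g (rotate m w) = gen_count g w"
  by (simp add: gen_count_def length_filter_rotate)

lemma cyc_reduced_rotate [simp]: "cyc_reduced (rotate m w) \<longleftrightarrow> cyc_reduced w"
  by (simp add: cyc_reduced_def gaps_rotate)

lemma gen_count_add_gen_count: "gen_count GenA w + gen_count GenB w = length w"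
proof (induction w)
  case (Cons c w)
  then show ?case by (cases c rule: letter_cases) (auto simp: gen_count_def)
qed (simp add: gen_count_def)

lemma cyc_reduced_iff: "cyc_reduced w \<longleftrightarrow> reduced w \<and> (w \<noteq> [] \<longrightarrow> hd w \<noteq> inv_letter (last w))"
proof (cases w)
  case (Cons c u)
  have "(\<forall>(x, y) \<in> set (zip (c # u) u). y \<noteq> inv_letter x) \<longleftrightarrow> reduced (c # u)"
    by (induction u arbitrary: c) (auto simp: reduced_Cons)
  with Cons show ?thesis by (auto simp: cyc_reduced_def gaps_Cons)
qed (simp add: cyc_reduced_def)

lemma C2_iff: "w \<in> C2 \<longleftrightarrow> cyc_reduced w"
  by (auto simp: C2_def F2_def cyc_reduced_iff)

text \<open>
  The drops not counting the one across the end of the word. Recursive arguments work with this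
  count; it agrees with the cyclic one once the word is rotated so that no drop lies across the
  end.
\<close>

fun lin_drops :: "word \<Rightarrow> nat" where
  "lin_drops (u # v # w) = (if snd u \<and> \<not> snd v then 1 else 0) + lin_drops (v # w)"
| "lin_drops _ = 0"

lemma drops_Cons:
  "drops (c # w) = lin_drops (c # w) + (if snd (last (c # w)) \<and> \<not> snd c then 1 else 0)"
proof -
  have "length (filter (\<lambda>(u, v). snd u \<and> \<not> snd v) (zip (c # w) w)) = lin_drops (c # w)"
    by (induction w arbitrary: c) auto
  then show ?thesis by (simp add: drops_def gaps_Cons)
qed

lemma drops_eq_lin_drops:
  "w \<noteq> [] \<Longrightarrow> snd (hd w) \<or> \<not> snd (last w) \<Longrightarrow> drops w = lin_drops w"
  by (cases w) (auto simp: drops_Cons)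

text \<open>
  The substitution \<open>a \<mapsto> ab\<close> together with the free reduction of the result. An inserted letter
  cancels exactly at a sign drop: \<open>ab\<inverse> \<mapsto> a\<close> and \<open>ba\<inverse> \<mapsto> a\<inverse>\<close>. Two sign drops never overlap, so one
  pass from left to right suffices.
\<close>

fun stretch :: "word \<Rightarrow> word" where
  "stretch [] = []"
| "stretch ((GenA, True) # (GenB, False) # w) = pa # stretch w"
| "stretch ((GenB, True) # (GenA, False) # w) = na # stretch w"
| "stretch ((GenA, True) # w) = pa # pb # stretch w"
| "stretch ((GenA, False) # w) = nb # na # stretch w"
| "stretch ((GenB, True) # w) = pb # stretch w"
| "stretch ((GenB, False) # w) = nb # stretch w"

lemma hom_of_stretch: "hom_of x y (stretch w) = hom_of (x + y) y w"
  by (induction w rule: stretch.induct) 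
    (simp_all add: add.assoc minus_add diff_conv_add_uminus del: add_uminus_conv_diff)

lemma stretch_eq_Nil_iff [simp]: "stretch w = [] \<longleftrightarrow> w = []"
  by (cases w rule: stretch.cases) auto

lemma hd_stretch:
  assumes "reduced w" "w \<noteq> []"
  shows "hd (stretch w) = pa \<longleftrightarrow> hd w = pa"
    and "hd (stretch w) = pb \<longleftrightarrow> hd w = pb \<and> (tl w = [] \<or> hd (tl w) \<noteq> na)"
    and "hd (stretch w) = nb \<longleftrightarrow> hd w = na \<or> hd w = nb"
    and "hd (stretch w) = na \<longleftrightarrow> hd w = pb \<and> tl w \<noteq> [] \<and> hd (tl w) = na"
  using assms by (cases w rule: stretch.cases; auto simp: reduced_Cons)+

lemma reduced_stretch: "reduced w \<Longrightarrow> reduced (stretch w)"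
  by (induction w rule: stretch.induct) (auto simp: reduced_Cons hd_stretch)

lemma last_stretch: "w \<noteq> [] \<Longrightarrow> last (stretch w) = na \<longleftrightarrow> last w = na"
  by (induction w rule: stretch.induct) auto

lemma lin_drops_Cons:
  "lin_drops (u # w) = (if w \<noteq> [] \<and> snd u \<and> \<not> snd (hd w) then 1 else 0) + lin_drops w"
  by (cases w) auto

lemma not_snd_iff: "\<not> snd c \<longleftrightarrow> c = na \<or> c = nb"
  by (cases c rule: letter_cases) auto

text \<open>
  Each sign drop of the image arises where one of \<open>w\<close> was consumed: after \<open>ab\<inverse> \<mapsto> a\<close> the next
  letter of the image may again be \<open>b\<inverse>\<close>, and after \<open>ba\<inverse> \<mapsto> a\<inverse>\<close> the remaining \<open>a\<inverse>\<close> may come to stand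
  behind another \<open>b\<close>, old or inserted. The extra summand reserves a drop consumed at the head of
  the word for the second case.
\<close>

lemma lin_drops_stretch:
  "reduced w \<Longrightarrow>
    lin_drops (stretch w) + (if w \<noteq> [] \<and> hd (stretch w) = na then 1 else 0) \<le> lin_drops w"
  by (induction w rule: stretch.induct)
    (auto simp: reduced_Cons lin_drops_Cons not_snd_iff hd_stretch split: if_splits)

lemma gen_count_simps [simp]: "gen_count g [] = 0" "gen_count g (c # w) = (if fst c = g then 1 else 0) + gen_count g w"
  by (simp_all add: gen_count_def)

lemma gen_count_stretch:
  "gen_count GenA (stretch w) = gen_count GenA w"
  "reduced w \<Longrightarrow> gen_count GenB (stretch w) + 2 * lin_drops w = gen_count GenB w + gen_count GenA w"
  by (induction w rule: stretch.induct)
    (auto simp: reduced_Cons lin_drops_Cons not_snd_iff)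

text \<open>
  If a word begins with \<open>a\<close> or ends with \<open>a\<inverse>\<close>, then so does its image under \<open>a \<mapsto> ab\<close>, and no
  cancellation and no sign drop lies across its end, before or after the substitution.
\<close>

lemma rotate_to_GenA:
  assumes "gen_count GenA w \<noteq> 0"
  obtains m where "w \<noteq> []" "hd (rotate m w) = pa \<or> last (rotate m w) = na"
proof -
  from assms have "filter (\<lambda>c. fst c = GenA) w \<noteq> []" by (auto simp: gen_count_def)
  then obtain c where "c \<in> set w" "fst c = GenA" by (auto simp: filter_empty_conv)
  then obtain i where i: "i < length w" "fst (w ! i) = GenA" by (metis in_set_conv_nth)
  then have ne: "w \<noteq> []" by auto
  then have hd: "hd (rotate i w) = w ! i" using i by (simp add: hd_rotate_conv_nth)
  have "last (rotate (Suc i) w) = w ! i"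
    using hd ne by (cases "rotate i w") auto
  with hd i(2) show thesis
    using that[of i] that[of "Suc i"] ne by (cases "w ! i" rule: letter_cases) auto
qed

lemma stretch_cyclic:
  assumes "cyc_reduced w" "w \<noteq> []" "hd w = pa \<or> last w = na"
  shows "cyc_reduced (stretch w)" and "drops (stretch w) \<le> drops w"
    and "gen_count GenB (stretch w) + 2 * drops w = gen_count GenB w + gen_count GenA w"
proof -
  have red: "reduced w" "hd w \<noteq> inv_letter (last w)"
    using assms by (auto simp: cyc_reduced_iff)
  have d: "drops w = lin_drops w"
    using assms by (intro drops_eq_lin_drops) auto
  have ends: "hd (stretch w) = pa \<longleftrightarrow> hd w = pa" "last (stretch w) = na \<longleftrightarrow> last w = na"
    using assms red by (simp_all add: hd_stretch last_stretch)
  then have d': "drops (stretch w) = lin_drops (stretch w)"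
    using assms by (intro drops_eq_lin_drops) auto
  show "cyc_reduced (stretch w)"
    using reduced_stretch[OF red(1)] ends assms red
    by (auto simp: cyc_reduced_iff) (metis inv_letter_inv_letter inv_letter_simps(1))+
  show "drops (stretch w) \<le> drops w"
    using lin_drops_stretch[OF red(1)] d d' by simp
  show "gen_count GenB (stretch w) + 2 * drops w = gen_count GenB w + gen_count GenA w"
    using gen_count_stretch(2)[OF red(1)] d by simp
qed

text \<open>
  Up to rotation, the two inequalities say that neither \<open>a \<mapsto> ab\<close> nor \<open>b \<mapsto> ba\<close> shortens the
  cyclic word.
\<close>

definition sparse :: "word \<Rightarrow> bool" where
  "sparse w \<longleftrightarrow> cyc_reduced w \<and> 2 * drops w \<le> gen_count GenA w \<and> 2 * drops w \<le> gen_count GenB w"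

text \<open>
  The conjugating element depends on the pair \<open>(x, y)\<close>, but the word \<open>w'\<close> does not: it is the
  stretched word of a suitable rotation of \<open>w\<close>.
\<close>

lemma sparse_stretch:
  assumes "sparse w"
  obtains w' where "sparse w'" and "length w \<le> length w'"
    and "\<And>x y. \<exists>g. hom_of (x + y) y w = g + hom_of x y w' - g"
proof (cases "gen_count GenA w = 0")
  case True
  have "hom_of (x + y) y w = hom_of x y w" for x y
    using True
  proof (induction w)
    case (Cons c w)
    then show ?case by (cases c rule: letter_cases) auto
  qed simp
  then have "\<exists>g. hom_of (x + y) y w = g + hom_of x y w - g" for x y
    by (intro exI[of _ 0]) simp
  with assms that[of w] show thesis by blast
next
  case False
  then obtain m where m: "w \<noteq> []" "hd (rotate m w) = pa \<or> last (rotate m w) = na"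
    by (rule rotate_to_GenA)
  define v where "v = rotate m w"
  have v: "cyc_reduced v" "v \<noteq> []" "hd v = pa \<or> last v = na" "sparse v"
    using assms m by (auto simp: v_def sparse_def)
  note st = stretch_cyclic[OF v(1-3)] gen_count_stretch(1)[of v]
  have "sparse (stretch v)"
    using st v(4) by (auto simp: sparse_def)
  moreover have "length v \<le> length (stretch v)"
    using st v(4) gen_count_add_gen_count[of v] gen_count_add_gen_count[of "stretch v"] by (simp add: sparse_def)
  then have "length w \<le> length (stretch v)" by (simp add: v_def)
  moreover have "\<exists>g. hom_of (x + y) y w = g + hom_of x y (stretch v) - g" for x y
  proof -
    obtain g where g: "hom_of (x + y) y v = g + hom_of (x + y) y w - g"
      using hom_of_rotate unfolding v_def by blast
    have "hom_of (x + y) y w = - g + hom_of (x + y) y v - - g"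
      unfolding g by (simp only: group_normalize)
    then show ?thesis unfolding hom_of_stretch by blast
  qed
  ultimately show thesis by (rule that)
qed

section \<open>Relabelling the letters\<close>

fun relabel :: "letter \<Rightarrow> letter \<Rightarrow> letter \<Rightarrow> letter" where
  "relabel c d (GenA, s) = (if s then c else inv_letter c)"
| "relabel c d (GenB, s) = (if s then d else inv_letter d)"

lemma hom_of_map_relabel: "hom_of x y (map (relabel c d) w) = hom_of (img x y c) (img x y d) w"
proof -
  have "img x y (relabel c d e) = img (img x y c) (img x y d) e" for e
    by (cases e rule: letter_cases) (simp_all add: img_inv_letter)
  then show ?thesis by (induction w) simp_all
qed

lemma cyc_reduced_map_relabel:
  assumes "fst c \<noteq> fst d" "cyc_reduced w"
  shows "cyc_reduced (map (relabel c d) w)"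
proof -
  have inv: "relabel c d (inv_letter u) = inv_letter (relabel c d u)" for u
    by (cases u rule: letter_cases) simp_all
  have fst_inv: "fst (inv_letter u) = fst u" for u by (simp add: inv_letter_def)
  have inj: "relabel c d u = relabel c d v \<longleftrightarrow> u = v" for u v
    using assms(1) fst_inv[of c] fst_inv[of d]
    by (cases u rule: letter_cases; cases v rule: letter_cases) auto
  have "relabel c d v \<noteq> inv_letter (relabel c d u)" if "(u, v) \<in> set (gaps w)" for u v
  proof -
    have "v \<noteq> inv_letter u" using that assms(2) by (auto simp: cyc_reduced_def)
    then show ?thesis unfolding inv[symmetric] inj .
  qed
  then show ?thesis
    unfolding cyc_reduced_def gaps_map set_map by (auto simp del: split_paired_All) metis
qed

abbreviation swap :: "letter \<Rightarrow> letter" where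
  "swap \<equiv> relabel pb pa"

abbreviation flip :: "letter \<Rightarrow> letter" where
  "flip \<equiv> relabel pa nb"

lemma gen_count_map_swap [simp]:
  "gen_count GenA (map swap w) = gen_count GenB w" "gen_count GenB (map swap w) = gen_count GenA w"
proof -
  have "gen_count GenA (map swap w) = gen_count GenB w \<and> gen_count GenB (map swap w) = gen_count GenA w"
  proof (induction w)
    case (Cons c w)
    then show ?case by (cases c rule: letter_cases) auto
  qed simp
  then show "gen_count GenA (map swap w) = gen_count GenB w" "gen_count GenB (map swap w) = gen_count GenA w" by auto
qed

lemma gen_count_map_flip [simp]: "gen_count g (map flip w) = gen_count g w"
proof (induction w)
  case (Cons c w)
  then show ?case by (cases c rule: letter_cases) auto
qed simp

lemma drops_map_swap [simp]: "drops (map swap w) = drops w"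
proof -
  have "snd (swap c) = snd c" for c by (cases c rule: letter_cases) auto
  then show ?thesis
    by (simp add: drops_def gaps_map filter_map comp_def case_prod_unfold)
qed

lemma sparse_map_swap: "sparse w \<Longrightarrow> sparse (map swap w)"
  by (simp add: sparse_def cyc_reduced_map_relabel)

section \<open>Positive substitutions do not shorten sparse words\<close>

lemma sum_list_replicate_conj:
  "sum_list (replicate n (h + z - h)) = h + sum_list (replicate n z) - (h :: fg)"
proof (induction n)
  case (Suc n)
  then show ?case by (simp only: replicate_Suc sum_list.Cons group_normalize)
qed simp

text \<open>
  A conjugate \<open>z\<close> of \<open>w\<close> gives \<open>|w\<^sup>n| \<le> n |z| + 2 |h|\<close> for all \<open>n\<close>. Since \<open>w\<^sup>n\<close> is reduced without
  cancellation, its length is \<open>n |w|\<close>, and a large \<open>n\<close> forces \<open>|w| \<le> |z|\<close>.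
\<close>

lemma length_le_len_conj:
  assumes "cyc_reduced w"
  shows "length w \<le> len (h + Fg w - h)"
proof (rule ccontr)
  assume less: "\<not> ?thesis"
  define z n where "z = h + Fg w - h" and "n = Suc (2 * len h)"
  have w: "reduced w" "w \<noteq> [] \<longrightarrow> hd w \<noteq> inv_letter (last w)"
    using assms by (auto simp: cyc_reduced_iff)
  have "w \<noteq> []" using less by auto
  have red: "reduced (concat (replicate k w))" for k
  proof (induction k)
    case (Suc k)
    then show ?case using w \<open>w \<noteq> []\<close> by (cases k) (auto simp: reduced_append)
  qed simp
  have Fg: "Fg (concat (replicate k w)) = sum_list (replicate k (Fg w))" for k
  proof (induction k)
    case (Suc k)
    then show ?case using red[of "Suc k"] by (simp add: Fg_append)
  qed (simp add: zero_fg_def)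
  have len_n: "len (sum_list (replicate k u)) \<le> k * len u" for k u
  proof (induction k)
    case (Suc k)
    have "len (u + sum_list (replicate k u)) \<le> len u + len (sum_list (replicate k u))"
      by (rule len_add_le)
    with Suc show ?case by simp
  qed simp
  have "sum_list (replicate n (Fg w)) = - h + (sum_list (replicate n z) + h)"
    unfolding z_def sum_list_replicate_conj by (simp only: group_normalize)
  then have "len (sum_list (replicate n (Fg w))) \<le> len h + (n * len z + len h)"
    using len_add_le[of "- h" "sum_list (replicate n z) + h"]
      len_add_le[of "sum_list (replicate n z)" h] len_n[of n z] by simp
  moreover have "length (concat (replicate k w)) = k * length w" for k
    by (induction k) simp_all
  then have "len (sum_list (replicate n (Fg w))) = n * length w"
    using red[of n] by (simp flip: Fg)
  ultimately have "n * length w \<le> n * len z + 2 * len h" by simp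
  moreover have "Suc (len z) \<le> length w" using less by (simp add: z_def)
  then have "n * Suc (len z) \<le> n * length w" by (rule mult_le_mono2)
  ultimately show False by (simp add: n_def)
qed

text \<open>
  The last substitution added to the pair is the first one applied to the word. It replaces \<open>w\<close> by
  a sparse word at least as long, to which the shorter product of substitutions applies. The
  conjugating \<open>h\<close> is needed since rotations of the word and the rule \<open>conj\<close> change the image by a
  conjugation.
\<close>

lemma pos_pair_length_le:
  "pos_pair x y \<Longrightarrow> sparse w \<Longrightarrow> length w \<le> len (h + hom_of x y w - h)"
proof (induction arbitrary: w h rule: pos_pair.induct)
  case (letters c d)
  have "cyc_reduced (map (relabel c d) w)"
    using letters by (intro cyc_reduced_map_relabel) (auto simp: sparse_def)
  moreover from this have "hom_of (lt c) (lt d) w = Fg (map (relabel c d) w)"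
    using hom_of_map_relabel[of "lt pa" "lt pb" c d w] hom_of_lt[of "map (relabel c d) w"]
    by (simp add: img_lt cyc_reduced_iff)
  ultimately show ?case
    using length_le_len_conj[of "map (relabel c d) w" h] by simp
next
  case (addL x y)
  from addL.prems obtain w' where w': "sparse w'" "length w \<le> length w'"
    "\<And>x y. \<exists>g. hom_of (x + y) y w = g + hom_of x y w' - g"
    by (rule sparse_stretch) blast
  then obtain g where "hom_of (x + y) y w = g + hom_of x y w' - g" by blast
  then have "h + hom_of (x + y) y w - h = (h + g) + hom_of x y w' - (h + g)"
    by (simp only: group_normalize)
  with addL.IH[OF w'(1), of "h + g"] w'(2) show ?case by simp
next
  case (addR x y)
  from sparse_map_swap[OF addR.prems] obtain w' where w': "sparse w'" "length (map swap w) \<le> length w'"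
    "\<And>x y. \<exists>g. hom_of (x + y) y (map swap w) = g + hom_of x y w' - g"
    by (rule sparse_stretch) blast
  from w'(3) obtain g where "hom_of (y + x) x (map swap w) = g + hom_of y x w' - g" by blast
  then have "hom_of x (y + x) w = g + hom_of x y (map swap w') - g"
    by (simp add: hom_of_map_relabel)
  then have "h + hom_of x (y + x) w - h = (h + g) + hom_of x y (map swap w') - (h + g)"
    by (simp only: group_normalize)
  with addR.IH[OF sparse_map_swap[OF w'(1)], of "h + g"] w'(2) show ?case by simp
next
  case (conj x y g)
  have "h + hom_of (g + x - g) (g + y - g) w - h = (h + g) + hom_of x y w - (h + g)"
    unfolding hom_of_conj by (simp only: group_normalize)
  with conj.IH[OF conj.prems, of "h + g"] show ?case by simp
qed

definition balanced :: "word \<Rightarrow> bool" where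
  "balanced w \<longleftrightarrow> sparse w \<and> sparse (map flip w)"

lemma signed_pair_length_le:
  assumes "signed_pair x y" "balanced w"
  shows "length w \<le> len (hom_of x y w)"
  using assms(1) unfolding signed_pair_def
proof
  assume "pos_pair x y"
  from pos_pair_length_le[OF this, of w 0] assms(2) show ?thesis by (simp add: balanced_def)
next
  assume "pos_pair x (- y)"
  from pos_pair_length_le[OF this, of "map flip w" 0] assms(2) show ?thesis
    by (simp add: balanced_def hom_of_map_relabel)
qed

section \<open>Minimal words\<close>

definition automorphism :: "(fg \<Rightarrow> fg) \<Rightarrow> bool" where
  "automorphism \<Phi> \<longleftrightarrow> bij \<Phi> \<and> (\<forall>x y. \<Phi> (x + y) = \<Phi> x + \<Phi> y)"

lemma additive_eq_hom_of:
  assumes "\<And>x y :: fg. \<Phi> (x + y) = \<Phi> x + (\<Phi> y :: fg)"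
  shows "\<Phi> z = hom_of (\<Phi> (lt pa)) (\<Phi> (lt pb)) (nf z)"
proof -
  have zero: "\<Phi> 0 = 0"
    using assms[of 0 0] by (metis add.right_neutral add_left_cancel)
  have "\<Phi> x + \<Phi> (- x) = 0" for x
    using assms[of x "- x"] zero by simp
  then have uminus: "\<Phi> (- x) = - \<Phi> x" for x
    by (metis minus_unique)
  have lt: "\<Phi> (lt c) = img (\<Phi> (lt pa)) (\<Phi> (lt pb)) c" for c
    using uminus[of "lt pa"] uminus[of "lt pb"]
    by (cases c rule: letter_cases) (simp_all flip: lt_inv_letter)
  have "\<Phi> (sum_list (map lt w)) = hom_of (\<Phi> (lt pa)) (\<Phi> (lt pb)) w" for w
    by (induction w) (simp_all add: zero assms lt[symmetric])
  from this[of "nf z"] show ?thesis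
    using Fg_eq_sum_list[of "nf z"] by simp
qed

lemma automorphism_hom_of:
  assumes "hom_of x y (nf x') = lt pa" "hom_of x y (nf y') = lt pb"
    and "hom_of x' y' (nf x) = lt pa" "hom_of x' y' (nf y) = lt pb"
  shows "automorphism (\<lambda>z. hom_of x y (nf z))"
proof -
  have inverse: "hom_of x y (nf (hom_of x' y' (nf z))) = z"
    if "hom_of x y (nf x') = lt pa" "hom_of x y (nf y') = lt pb" for x y x' y' z
    using that additive_eq_hom_of[of "\<lambda>z. hom_of x y (nf (hom_of x' y' (nf z)))" z]
    by (simp add: hom_of_nf_plus hom_of_lt)
  have "bij (\<lambda>z. hom_of x y (nf z))"
    by (rule bij_betw_byWitness[where f' = "\<lambda>z. hom_of x' y' (nf z)"]) (use assms inverse in auto)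
  then show ?thesis by (simp add: automorphism_def hom_of_nf_plus)
qed

lemma automorphism_comp: "automorphism \<Phi> \<Longrightarrow> automorphism \<Psi> \<Longrightarrow> automorphism (\<Phi> \<circ> \<Psi>)"
  by (auto simp: automorphism_def intro: bij_comp)

lemma automorphism_conj: "automorphism (\<lambda>z. g + z - g)"
proof -
  have "bij (\<lambda>z. g + z - g)"
    by (rule bij_betw_byWitness[where f' = "\<lambda>z. - g + z - - g"])
      (auto simp only: group_normalize)
  moreover have "g + (x + y) - g = g + x - g + (g + y - g)" for x y
    by (simp only: group_normalize)
  ultimately show ?thesis by (simp add: automorphism_def)
qed

lemma automorphism_swap: "automorphism (\<lambda>z. hom_of (lt pb) (lt pa) (nf z))"
  by (rule automorphism_hom_of[of _ _ "lt pb" "lt pa"]) simp_all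

lemma automorphism_flip: "automorphism (\<lambda>z. hom_of (lt pa) (lt nb) (nf z))"
  by (rule automorphism_hom_of[of _ _ "lt pa" "lt nb"]) (simp_all flip: lt_inv_letter)

lemma automorphism_stretch: "automorphism (\<lambda>z. hom_of (lt pa + lt pb) (lt pb) (nf z))"
proof (rule automorphism_hom_of[of _ _ "lt pa + lt nb" "lt pb"])
  show "hom_of (lt pa + lt pb) (lt pb) (nf (lt pa + lt nb)) = lt pa"
    by (simp add: hom_of_nf_plus)
  show "hom_of (lt pa + lt nb) (lt pb) (nf (lt pa + lt pb)) = lt pa"
    using lt_inv_letter[of pb] by (simp add: hom_of_nf_plus)
qed simp_all

definition minimal :: "fg \<Rightarrow> bool" where
  "minimal z \<longleftrightarrow> (\<forall>\<Phi>. automorphism \<Phi> \<longrightarrow> len z \<le> len (\<Phi> z))"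

lemma minimal_image:
  assumes "minimal z" "automorphism \<Psi>" "len (\<Psi> z) \<le> len z"
  shows "minimal (\<Psi> z)"
  unfolding minimal_def
proof (intro allI impI)
  fix \<Phi> assume "automorphism \<Phi>"
  then have "len z \<le> len (\<Phi> (\<Psi> z))"
    using assms(1,2) automorphism_comp[of \<Phi> \<Psi>] by (auto simp: minimal_def)
  with assms(3) show "len (\<Psi> z) \<le> len (\<Phi> (\<Psi> z))" by simp
qed

lemma carrier_F2: "carrier F2 = {w. reduced w}"
  by (simp add: F2_def)

lemma mult_F2: "u \<otimes>\<^bsub>F2\<^esub> v = mult_red u v"
  by (simp add: F2_def)

lemma automorphism_of_iso:
  assumes "\<phi> \<in> iso F2 F2"
  shows "automorphism (\<lambda>z. Fg (\<phi> (nf z)))"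
proof -
  have hom: "\<And>u v. reduced u \<Longrightarrow> reduced v \<Longrightarrow> \<phi> (mult_red u v) = mult_red (\<phi> u) (\<phi> v)"
    and bij: "bij_betw \<phi> {w. reduced w} {w. reduced w}"
    using assms by (auto simp: iso_def hom_def carrier_F2 mult_F2)
  have nf: "bij_betw nf UNIV {w. reduced w}"
    by (rule bij_betw_byWitness[where f' = Fg]) auto
  have Fg: "bij_betw Fg {w. reduced w} UNIV"
    by (rule bij_betw_byWitness[where f' = nf]) auto
  have red: "reduced (\<phi> (nf z))" for z
    using bij_betwE[OF bij] by auto
  have "bij (\<lambda>z. Fg (\<phi> (nf z)))"
    using bij_betw_trans[OF bij_betw_trans[OF nf bij] Fg] by (simp add: comp_def)
  then show ?thesis
    by (simp add: automorphism_def hom red plus_fg_def reduced_mult_red)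
qed

lemma iso_of_automorphism:
  assumes "automorphism \<Phi>"
  shows "(\<lambda>w. nf (\<Phi> (Fg w))) \<in> iso F2 F2"
proof -
  have nf: "bij_betw nf UNIV {w. reduced w}"
    by (rule bij_betw_byWitness[where f' = Fg]) auto
  have Fg: "bij_betw Fg {w. reduced w} UNIV"
    by (rule bij_betw_byWitness[where f' = nf]) auto
  have "bij_betw (\<lambda>w. nf (\<Phi> (Fg w))) {w. reduced w} {w. reduced w}"
    using bij_betw_trans[OF bij_betw_trans[OF Fg, of \<Phi> UNIV] nf] assms
    by (simp add: comp_def automorphism_def)
  moreover have "Fg (mult_red u v) = Fg u + Fg v" if "reduced u" "reduced v" for u v
    using that by (simp add: plus_fg_def)
  ultimately show ?thesis
    using assms by (auto simp: iso_def hom_def carrier_F2 mult_F2 automorphism_def nf_plus)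
qed

lemma minimal_word_iff: "minimal_word w \<longleftrightarrow> reduced w \<and> minimal (Fg w)"
proof (cases "reduced w")
  case red: True
  show ?thesis
  proof
    assume min: "minimal_word w"
    show "reduced w \<and> minimal (Fg w)"
      using min red iso_of_automorphism
      unfolding minimal_word_def minimal_def len_def by fastforce
  next
    assume min: "reduced w \<and> minimal (Fg w)"
    have "length w \<le> length (\<phi> w)" if "\<phi> \<in> iso F2 F2" for \<phi>
    proof -
      have "reduced (\<phi> w)"
        using that red by (auto simp: iso_def hom_def carrier_F2)
      then show ?thesis
        using automorphism_of_iso[OF that] min red by (force simp: minimal_def)
    qed
    with red show "minimal_word w" by (simp add: minimal_word_def carrier_F2)
  qed
qed (simp add: minimal_word_def carrier_F2)

text \<open>
  The images of the generators under an automorphism generate the group, so they form a signed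
  pair. A pair positive in \<open>a\<close> and \<open>b\<close> uses the bounds for \<open>w\<close>, a pair positive in \<open>a\<close> and \<open>b\<inverse>\<close>
  those for the flipped word.
\<close>

lemma balanced_imp_minimal:
  assumes "balanced w"
  shows "minimal_word w"
proof -
  have red: "reduced w" using assms by (auto simp: balanced_def sparse_def cyc_reduced_iff)
  have "length w \<le> len (\<Phi> (Fg w))" if "automorphism \<Phi>" for \<Phi>
  proof -
    have eq: "\<Phi> z = hom_of (\<Phi> (lt pa)) (\<Phi> (lt pb)) (nf z)" for z
      by (rule additive_eq_hom_of) (use that in \<open>simp add: automorphism_def\<close>)
    have "generates (\<Phi> (lt pa)) (\<Phi> (lt pb))"
      unfolding generates_def
    proof
      fix z
      from that obtain u where "z = \<Phi> u" unfolding automorphism_def by (metis bij_pointE)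
      with eq[of u] show "\<exists>w. hom_of (\<Phi> (lt pa)) (\<Phi> (lt pb)) w = z" by metis
    qed
    from signed_pair_length_le[OF generates_imp_signed_pair[OF this] assms] show ?thesis
      using eq[of "Fg w"] red by simp
  qed
  with red show ?thesis by (simp add: minimal_word_iff minimal_def)
qed

text \<open>
  If the last letter is inverse to the first, conjugation by that letter removes both.
\<close>

lemma minimal_cyc_reduced:
  assumes "minimal_word w"
  shows "cyc_reduced w"
proof (rule ccontr)
  assume not: "\<not> cyc_reduced w"
  have min: "reduced w" "minimal (Fg w)" using assms by (auto simp: minimal_word_iff)
  with not have w: "w \<noteq> []" "hd w = inv_letter (last w)" by (auto simp: cyc_reduced_iff)
  obtain c u where c: "w = c # u" using w(1) by (cases w) auto
  with w(2) have "u \<noteq> []" by auto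
  then obtain r where "w = c # r @ [last w]" using c by (metis append_butlast_last_id last_ConsR)
  with w(2) c have r: "w = c # r @ [inv_letter c]" by (metis inv_letter_inv_letter list.sel(1))
  have red: "reduced r" using min(1) r by (simp add: reduced_Cons reduced_append)
  have "Fg w = lt c + (Fg r + - lt c)"
    using min(1) red unfolding r by (simp add: Fg_eq_sum_list lt_inv_letter del: add_uminus_conv_diff)
  then have "- lt c + Fg w - - lt c = Fg r"
    by (simp only: group_normalize)
  then have "len (Fg w) \<le> len (Fg r)"
    using min(2) automorphism_conj[of "- lt c"] unfolding minimal_def by metis
  then show False using red min(1) by (simp add: r)
qed

lemma drops_eq_0:
  assumes "cyc_reduced w" "gen_count GenA w = 0"
  shows "drops w = 0"
proof -
  have "\<not> (snd u \<and> \<not> snd v)" if "(u, v) \<in> set (gaps w)" for u v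
  proof -
    have "u \<in> set w" "v \<in> set w"
      using that by (auto simp: gaps_def dest: set_zip_leftD set_zip_rightD)
    then have "fst u = GenB" "fst v = GenB"
      using assms(2) by (auto simp: gen_count_def filter_empty_conv) (metis gen.exhaust)+
    moreover have "v \<noteq> inv_letter u" using assms(1) that by (auto simp: cyc_reduced_def)
    ultimately show ?thesis by (cases u; cases v) (auto simp: inv_letter_def)
  qed
  then show ?thesis by (auto simp: drops_def filter_empty_conv)
qed

text \<open>
  The automorphism \<open>a \<mapsto> ab\<close>, applied to a suitable rotation, changes the length by the difference
  of the two sides.
\<close>

lemma minimal_drops_le:
  assumes "minimal_word w"
  shows "2 * drops w \<le> gen_count GenA w"
proof (cases "gen_count GenA w = 0")
  case True
  with drops_eq_0[OF minimal_cyc_reduced[OF assms]] show ?thesis by simp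
next
  case False
  then obtain m where m: "w \<noteq> []" "hd (rotate m w) = pa \<or> last (rotate m w) = na"
    by (rule rotate_to_GenA)
  define v where "v = rotate m w"
  have v: "cyc_reduced v" "v \<noteq> []" "hd v = pa \<or> last v = na"
    using minimal_cyc_reduced[OF assms] m by (auto simp: v_def)
  have red: "reduced w" "reduced v"
    using minimal_cyc_reduced[OF assms] v(1) by (auto simp: cyc_reduced_iff)
  obtain g where g: "Fg v = g + Fg w - g"
    using hom_of_rotate[of "lt pa" "lt pb" m w] red by (auto simp: hom_of_lt v_def[symmetric])
  have "minimal (Fg v)"
    unfolding g using assms automorphism_conj
  proof (intro minimal_image[where \<Psi> = "\<lambda>z. g + z - g"])
    show "len (g + Fg w - g) \<le> len (Fg w)" using red by (simp flip: g) (simp add: v_def)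
  qed (simp_all add: minimal_word_iff)
  then have "len (Fg v) \<le> len (hom_of (lt pa + lt pb) (lt pb) (nf (Fg v)))"
    using automorphism_stretch unfolding minimal_def by blast
  also have "hom_of (lt pa + lt pb) (lt pb) (nf (Fg v)) = Fg (stretch v)"
    using red(2) reduced_stretch[OF red(2)] by (simp add: hom_of_lt flip: hom_of_stretch)
  finally have "length v \<le> length (stretch v)"
    using red(2) reduced_stretch[OF red(2)] by simp
  moreover note stretch_cyclic(3)[OF v] gen_count_stretch(1)[of v]
  ultimately have "2 * drops v \<le> gen_count GenA v"
    using gen_count_add_gen_count[of v] gen_count_add_gen_count[of "stretch v"] by linarith
  then show ?thesis by (simp add: v_def)
qed

lemma minimal_relabel:
  assumes "minimal_word w" "fst c \<noteq> fst d" "automorphism (\<lambda>z. hom_of (lt c) (lt d) (nf z))"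
  shows "minimal_word (map (relabel c d) w)"
proof -
  have red: "reduced w" "reduced (map (relabel c d) w)"
    using minimal_cyc_reduced[OF assms(1)] cyc_reduced_map_relabel[OF assms(2)]
    by (auto simp: cyc_reduced_iff)
  have "Fg (map (relabel c d) w) = hom_of (lt c) (lt d) (nf (Fg w))"
    using red hom_of_map_relabel[of "lt pa" "lt pb" c d w] by (simp add: hom_of_lt img_lt)
  with minimal_image[OF _ assms(3), of "Fg w"] assms(1) red show ?thesis
    by (metis len_Fg length_map minimal_word_iff order_refl)
qed

lemma minimal_imp_balanced:
  assumes "minimal_word w"
  shows "balanced w"
proof -
  have "sparse u" if "minimal_word u" for u
  proof -
    have "minimal_word (map swap u)"
      by (rule minimal_relabel[OF that _ automorphism_swap]) simp
    from minimal_drops_le[OF this] minimal_drops_le[OF that] minimal_cyc_reduced[OF that]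
    show ?thesis by (simp add: sparse_def)
  qed
  moreover have "minimal_word (map flip w)"
    by (rule minimal_relabel[OF assms _ automorphism_flip]) simp
  ultimately show ?thesis using assms by (simp add: balanced_def)
qed

section \<open>Root words\<close>

lemma sum_list_gaps:
  "(\<Sum>(u, v) \<leftarrow> gaps w. f u + g v) = (\<Sum>c \<leftarrow> w. f c + (g c :: int))"
proof -
  have "(\<Sum>(u, v) \<leftarrow> zip xs ys. f u + g v) = sum_list (map f xs) + sum_list (map g ys)"
    if "length xs = length ys" for xs ys
    using that by (induction xs ys rule: list_induct2) auto
  moreover have "sum_list (map g (rotate1 w)) = sum_list (map g w)"
    by (cases w) auto
  ultimately show ?thesis by (simp add: gaps_def sum_list_addf)
qed

lemma drops_eq_sum_list: "int (drops w) = (\<Sum>(u, v) \<leftarrow> gaps w. of_bool (snd u \<and> \<not> snd v))"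
proof -
  have "int (length (filter P xs)) = (\<Sum>x \<leftarrow> xs. of_bool (P x))" for P and xs :: "(letter \<times> letter) list"
    by (induction xs) auto
  then show ?thesis by (simp add: drops_def case_prod_unfold)
qed

text \<open>
  The letters of a generator are counted by a sum over the gaps, in which a gap contributes one weight
  for its left letter and one for its right letter. For the generator \<open>a\<close>, a letter \<open>a\<close> is counted at the gap after it and \<open>a\<inverse>\<close> at the
  gap before it; without doubled letters this gap is one of \<open>ab\<close>, \<open>ab\<inverse>\<close>, \<open>ba\<inverse>\<close>, \<open>b\<inverse>a\<inverse>\<close>, a sign drop
  of \<open>w\<close> or of its flip. For the generator \<open>b\<close>, the number of letters is written as the number of gaps
  not starting with \<open>a\<inverse>\<close> minus the number of gaps ending in \<open>a\<close>. These weights are again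
  bounded gap by gap, although the letters \<open>b\<close> cannot be matched to drops one at a time: \<open>ba\<close> is
  not a drop of either kind.
\<close>

lemma ex_repeated_letter:
  assumes "cyc_reduced w" and less: "drops w + drops (map flip w) < gen_count g w"
  shows "\<exists>u. (u, u) \<in> set (gaps w) \<and> fst u = g"
proof (rule ccontr)
  assume none: "\<not> ?thesis"
  define f h :: "letter \<Rightarrow> int" where
    "f = (\<lambda>u. if g = GenA then of_bool (u = pa) else of_bool (u \<noteq> na))" and
    "h = (\<lambda>v. if g = GenA then of_bool (v = na) else - of_bool (v = pa))"
  have "int (gen_count g w) = (\<Sum>c \<leftarrow> w. f c + h c)"
  proof (induction w)
    case (Cons c w)
    then show ?case
      by (cases g; cases c rule: letter_cases) (simp_all add: f_def h_def)
  qed simp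
  also have "\<dots> = (\<Sum>(u, v) \<leftarrow> gaps w. f u + h v)"
    by (rule sum_list_gaps[symmetric])
  also have "\<dots> \<le> (\<Sum>(u, v) \<leftarrow> gaps w.
      of_bool (snd u \<and> \<not> snd v) + of_bool (snd (flip u) \<and> \<not> snd (flip v)))"
  proof (rule sum_list_mono)
    fix p assume p: "p \<in> set (gaps w)"
    obtain u v where uv: "p = (u, v)" by (cases p)
    have "v \<noteq> inv_letter u" using assms(1) p uv by (auto simp: cyc_reduced_def)
    moreover have "\<not> (u = v \<and> fst u = g)" using none p uv by blast
    ultimately have "f u + h v \<le> of_bool (snd u \<and> \<not> snd v) + of_bool (snd (flip u) \<and> \<not> snd (flip v))"
      by (cases u rule: letter_cases; cases v rule: letter_cases; cases g) (simp_all add: f_def h_def)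
    then show "(case p of (u, v) \<Rightarrow> f u + h v) \<le> (case p of (u, v) \<Rightarrow>
        of_bool (snd u \<and> \<not> snd v) + of_bool (snd (flip u) \<and> \<not> snd (flip v)))"
      by (simp add: uv)
  qed
  also have "\<dots> = int (drops w) + int (drops (map flip w))"
    by (simp add: drops_eq_sum_list gaps_map comp_def case_prod_unfold sum_list_addf)
  finally show False using less by simp
qed

lemma gaps_double: "gaps (u # u # r) = (u, u) # gaps (u # r)"
  by (simp add: gaps_Cons)

text \<open>
  Minimality bounds the count from below. If it were larger, a doubled letter \<open>uu\<close> would exist;
  the gap \<open>(u, u)\<close> is not a drop, so deleting one \<open>u\<close> keeps both numbers of drops and the word
  stays balanced.
\<close>

lemma root_word_gen_count_eq:
  assumes root: "root_word w" and len: "2 \<le> length w"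
  shows "gen_count g w = 2 * max (drops w) (drops (map flip w))"
proof (rule ccontr)
  assume neq: "\<not> ?thesis"
  define k where "k = max (drops w) (drops (map flip w))"
  have min: "minimal_word w" using root by (simp add: root_word_def)
  note bal = minimal_imp_balanced[OF min]
  have cyc: "cyc_reduced w" using bal by (simp add: balanced_def sparse_def)
  have le: "2 * k \<le> gen_count g' w" for g'
    using bal by (cases g') (auto simp: balanced_def sparse_def k_def)
  have less: "2 * k < gen_count g w" using le[of g] neq by (simp add: k_def)
  then have "drops w + drops (map flip w) < gen_count g w" by (simp add: k_def)
  from ex_repeated_letter[OF cyc this] obtain u where u: "(u, u) \<in> set (gaps w)" "fst u = g" by blast
  then obtain i where i: "i < length (gaps w)" "gaps w ! i = (u, u)" by (metis in_set_conv_nth)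
  have "hd (gaps (rotate i w)) = (u, u)"
    unfolding gaps_rotate using i by (subst hd_rotate_conv_nth) auto
  moreover have "2 \<le> length (rotate i w)" using len by simp
  then obtain a b r where abr: "rotate i w = a # b # r"
    by (metis Suc_le_length_iff numeral_2_eq_2)
  ultimately have rot: "rotate i w = u # u # r" by (simp add: gaps_Cons)
  define v where "v = u # r"
  have gaps: "gaps (rotate i w) = (u, u) # gaps v"
    unfolding rot v_def by (rule gaps_double)
  have gaps': "gaps (rotate i (map flip w)) = (flip u, flip u) # gaps (map flip v)"
    unfolding rotate_map rot v_def list.map by (rule gaps_double)
  have drops: "drops v = drops w" "drops (map flip v) = drops (map flip w)"
    using drops_rotate[of i w] drops_rotate[of i "map flip w"]
    unfolding drops_def gaps gaps' by auto
  have "cyc_reduced (rotate i w)" using cyc by simp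
  then have "cyc_reduced v" unfolding cyc_reduced_def gaps by simp
  moreover have gen_count: "gen_count g' w = (if g' = g then 1 else 0) + gen_count g' v" for g'
    using gen_count_rotate[of g' i w] u(2) unfolding rot v_def by auto
  have "2 * k \<le> gen_count g' v" for g'
    using le[of g'] less gen_count[of g'] by (auto split: if_splits)
  ultimately have "balanced v"
    unfolding balanced_def sparse_def using cyc_reduced_map_relabel[of pa nb v]
    by (simp add: drops k_def) (meson le_trans max.cobounded1 max.cobounded2 mult_le_mono2)
  then have "minimal_word v" by (rule balanced_imp_minimal)
  moreover have "child w v"
  proof -
    have "rotate i w = double_at 0 (rotate 0 v)"
      by (simp add: rot v_def double_at_def)
    moreover have "0 < length v" by (simp add: v_def)
    ultimately have "\<exists>m n j. j < length v \<and> rotate m w = double_at j (rotate n v)"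
      by blast
    then show ?thesis
      using cyc \<open>cyc_reduced v\<close> by (simp add: child_def C2_iff v_def)
  qed
  ultimately show False using root by (auto simp: root_word_def)
qed

theorem theorem11:
  fixes w :: word
  assumes "w \<in> carrier F2"
    and "root_word w"
  shows "4 dvd length w"
proof (cases "2 \<le> length w")
  case True
  define k where "k = max (drops w) (drops (map flip w))"
  have "length w = gen_count GenA w + gen_count GenB w"
    by (rule gen_count_add_gen_count[symmetric])
  also have "\<dots> = 4 * k"
    using root_word_gen_count_eq[OF assms(2) True] by (simp add: k_def)
  finally show ?thesis by simp
next
  case False
  have "w = []"
  proof (rule ccontr)
    assume "w \<noteq> []"
    with False obtain x where x: "w = [x]" by (cases w; cases "tl w") auto
    have "child w []"
      by (simp add: child_def C2_iff x cyc_reduced_iff)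
    moreover have "minimal_word []"
      by (simp add: minimal_word_def carrier_F2)
    ultimately show False using assms(2) by (auto simp: root_word_def)
  qed
  then show ?thesis by simp
qed

end
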